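(* Assume the setting below. Let $\mathcal{X},\mathcal{Y}\subseteq\mathcal{A}$ be disjoint, let $\tilde P=P^{\mathcal{X}}_{\mathcal{Y}}$, $\tilde K$, $\tilde{\boldsymbol{\tau}}$, $\tilde{\boldsymbol{\zeta}}$ be as defined below. Assume (1) $\mathcal{X}=\mathcal{S}\cup\mathcal{C}$ where $\tilde\zeta_j<1$ for all $j\in\mathcal{S}$ and $\tilde\zeta_j=1$ for all $j\in\mathcal{C}$, and (2) $\tilde\zeta_j<1$ for all $j\in\mathcal{Y}$. Let $\tilde M$ be the submatrix of $\mathcal{H}_{\tilde K}(\tilde{\boldsymbol{\tau}})^{-1}$ formed by the rows and columns indexed by $\mathcal{C}$. Then, as $n\to+\infty$, \[ \mathbb{P}\big(m\succ_{\boldsymbol{\alpha}}\mathcal{X}\wedge m\preccurlyeq_{\boldsymbol{\alpha}}\mathcal{Y}\big)\sim \frac{\tilde P(\tilde{\boldsymbol{\zeta}})^n}{\prod_{j\in\mathcal{S}}\tilde\zeta_j^{\lceil\beta_jn\rceil-1}\prod_{j\in\mathcal{Y}}\tilde\zeta_j^{\lfloor\alpha_jn\rfloor}}\cdot\frac{1}{\prod_{j\in\mathcal{S}\cup\mathcal{Y}}(1-\tilde\zeta_j)}\cdot\frac{1}{\sqrt{(2\pi)^{|\mathcal{X}\cup\mathcal{Y}|}\,n^{|\mathcal{S}\cup\mathcal{Y}|}\det(\mathcal{H}_{\tilde K}(\tilde{\boldsymbol{\tau}}))}}\int_{(0,+\infty)^{|\mathcal{C}|}}e^{-\mathbf{u}^T\tilde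 M\mathbf{u}/2}\,d\mathbf{u}. \]
   Context: Fix an integer $m\ge 2$ of candidates $\{1,\dots,m\}$ and let $\mathcal{A}=\{1,\dots,m-1\}$. There are $n$ voters; each voter independently draws a strict ranking $r$ of the candidates with probability $p_r$, where $p_r>0$ for each of the $m!$ rankings and $\sum_r p_r=1$ (independent of $n$). For $\mathcal{Z}\subseteq\mathcal{A}$, let $p_{\mathcal{Z}}$ be the probability that, in a random ranking, the set of adversaries ranked above $m$ is exactly $\mathcal{Z}$; let $P(\mathbf{x})=\sum_{\mathcal{Z}\subseteq\mathcal{A}} p_{\mathcal{Z}}\prod_{j\in\mathcal{Z}}x_j$. Fix $\boldsymbol{\alpha}\in(0,1)^{m-1}$, $\boldsymbol{\beta}=\mathbf{1}-\boldsymbol{\alpha}$. For $j\in\mathcal{A}$, write $m\succ_{\boldsymbol\alpha} j$ if strictly more than $\alpha_jn$ voters rank $m$ above $j$, and $m\preccurlyeq_{\boldsymbol\alpha} j$ otherwise (at most $\alpha_jn$ voters rank $m$ above $j$); $m\succ_{\boldsymbol\alpha}\mathcal{X}$ means $m\succ_{\boldsymbol\alpha}j$ for all $j\in\mathcal{X}$, and similarly for $m\preccurlyeq_{\boldsymbol\alpha}\mathcal{Y}$. For disjoint $\mathcal{X},\mathcal{Y}\subseteq\mathcal{A}$ define the polynomial in variables $(x_j)_{j\in\mathcal{X}},(y_j)_{j\in\mathcal{Y}}$: $P^{\mathcal{X}}_{\mathcal{Y}}(\mathbf{x}_{\mathcal{X}},\mathbf{y}_{\mathcal{Y}})=\big(\prod_{j\in\mathcal{Y}}y_j\big)\,P(\mathbf{x}')$,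 where $x'_j=x_j$ for $j\in\mathcal{X}$, $x'_j=1/y_j$ for $j\in\mathcal{Y}$, and $x'_j=1$ otherwise. Let $\tilde K(\mathbf{t})=\log P^{\mathcal{X}}_{\mathcal{Y}}(e^{\mathbf{t}})$ for $\mathbf{t}\in\mathbb{R}^{|\mathcal{X}\cup\mathcal{Y}|}$, let $\tilde{\boldsymbol\tau}$ be the maximizer of $\mathbf{t}\mapsto-\tilde K(\mathbf{t})+(\boldsymbol\beta_{\mathcal{X}},\boldsymbol\alpha_{\mathcal{Y}})^T\mathbf{t}$ (the vector of thresholds is $\beta_j$ on coordinates $j\in\mathcal{X}$ and $\alpha_j$ on coordinates $j\in\mathcal{Y}$), and $\tilde{\boldsymbol\zeta}=e^{\tilde{\boldsymbol\tau}}$ componentwise (the saddle point associated with $\mathbb{P}(m\succ_{\boldsymbol\alpha}\mathcal{X}\wedge m\preccurlyeq_{\boldsymbol\alpha}\mathcal{Y})$); $\mathcal{H}_{\tilde K}(\tilde{\boldsymbol\tau})$ is the Hessian of $\tilde K$ at $\tilde{\boldsymbol\tau}$. When $\mathcal{C}=\emptyset$ the integral is interpreted as $1$. *)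

theory Defs
  imports "HOL-Probability.Probability" "HOL-Combinatorics.Multiset_Permutations"
          "HOL-Library.Landau_Symbols"
begin

text \<open>Rankings of the candidates 1..m: lists (best first) that are permutations of 1..m.\<close>
definition rankings :: "nat \<Rightarrow> nat list set" where
  "rankings m = permutations_of_set {1..m}"

definition ranks_above :: "nat list \<Rightarrow> nat \<Rightarrow> nat \<Rightarrow> bool" where
  "ranks_above r a b \<longleftrightarrow> (\<exists>i j. i < j \<and> j < length r \<and> r ! i = a \<and> r ! j = b)"

definition adversaries :: "nat \<Rightarrow> nat set" where
  "adversaries m = {1..m - 1}"

definition num_m_above :: "nat \<Rightarrow> nat \<Rightarrow> (nat \<Rightarrow> nat list) \<Rightarrow> nat \<Rightarrow> nat" where
  "num_m_above m n v j = card {i \<in> {..<n}. ranks_above (v i) m j}"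

definition event_XY :: "nat \<Rightarrow> (nat \<Rightarrow> real) \<Rightarrow> nat \<Rightarrow> nat set \<Rightarrow> nat set
    \<Rightarrow> (nat \<Rightarrow> nat list) \<Rightarrow> bool" where
  "event_XY m \<alpha> n X Y v \<longleftrightarrow>
     (\<forall>j\<in>X. real (num_m_above m n v j) > \<alpha> j * real n) \<and>
     (\<forall>j\<in>Y. real (num_m_above m n v j) \<le> \<alpha> j * real n)"

definition prob_XY :: "nat \<Rightarrow> (nat list \<Rightarrow> real) \<Rightarrow> (nat \<Rightarrow> real) \<Rightarrow> nat \<Rightarrow> nat set
    \<Rightarrow> nat set \<Rightarrow> real" where
  "prob_XY m p \<alpha> n X Y =
     (\<Sum>v \<in> {v \<in> PiE {..<n} (\<lambda>_. rankings m). event_XY m \<alpha> n X Y v}. \<Prod>i<n. p (v i))"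

definition pZ :: "nat \<Rightarrow> (nat list \<Rightarrow> real) \<Rightarrow> nat set \<Rightarrow> real" where
  "pZ m p Z = (\<Sum>r \<in> {r \<in> rankings m. {j \<in> adversaries m. ranks_above r j m} = Z}. p r)"

definition polyP :: "nat \<Rightarrow> (nat list \<Rightarrow> real) \<Rightarrow> (nat \<Rightarrow> real) \<Rightarrow> real" where
  "polyP m p x = (\<Sum>Z \<in> Pow (adversaries m). pZ m p Z * (\<Prod>j\<in>Z. x j))"

text \<open>P^X_Y; the variables x_j (j in X) and y_j (j in Y) are stored in one function w.\<close>
definition polyPXY :: "nat \<Rightarrow> (nat list \<Rightarrow> real) \<Rightarrow> nat set \<Rightarrow> nat set \<Rightarrow> (nat \<Rightarrow> real) \<Rightarrow> real" where
  "polyPXY m p X Y w = (\<Prod>j\<in>Y. w j) *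
     polyP m p (\<lambda>j. if j \<in> X then w j else if j \<in> Y then 1 / w j else 1)"

definition Ktilde :: "nat \<Rightarrow> (nat list \<Rightarrow> real) \<Rightarrow> nat set \<Rightarrow> nat set \<Rightarrow> (nat \<Rightarrow> real) \<Rightarrow> real" where
  "Ktilde m p X Y t = ln (polyPXY m p X Y (\<lambda>j. exp (t j)))"

text \<open>The function  t |-> -K(t) + (beta_X, alpha_Y)^T t  whose maximizer is tau.\<close>
definition saddle_obj :: "nat \<Rightarrow> (nat list \<Rightarrow> real) \<Rightarrow> (nat \<Rightarrow> real) \<Rightarrow> nat set \<Rightarrow> nat set
    \<Rightarrow> (nat \<Rightarrow> real) \<Rightarrow> real" where
  "saddle_obj m p \<alpha> X Y t = - Ktilde m p X Y t + (\<Sum>j\<in>X. (1 - \<alpha> j) * t j) + (\<Sum>j\<in>Y. \<alpha> j * t j)"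

definition partial_deriv :: "nat \<Rightarrow> ((nat \<Rightarrow> real) \<Rightarrow> real) \<Rightarrow> (nat \<Rightarrow> real) \<Rightarrow> real" where
  "partial_deriv i f t = deriv (\<lambda>s. f (t(i := s))) (t i)"

definition hessian :: "((nat \<Rightarrow> real) \<Rightarrow> real) \<Rightarrow> (nat \<Rightarrow> real) \<Rightarrow> nat \<Rightarrow> nat \<Rightarrow> real" where
  "hessian f t i j = partial_deriv i (\<lambda>t'. partial_deriv j f t') t"

definition det_on :: "nat set \<Rightarrow> (nat \<Rightarrow> nat \<Rightarrow> real) \<Rightarrow> real" where
  "det_on I M = (\<Sum>\<pi> \<in> {\<pi>. \<pi> permutes I}. of_int (sign \<pi>) * (\<Prod>i\<in>I. M i (\<pi> i)))"

definition inverse_on :: "nat set \<Rightarrow> (nat \<Rightarrow> nat \<Rightarrow> real) \<Rightarrow> nat \<Rightarrow> nat \<Rightarrow> real" where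
  "inverse_on I M = (THE N. (\<forall>i\<in>I. \<forall>j\<in>I. (\<Sum>k\<in>I. M i k * N k j) = (if i = j then 1 else 0)) \<and>
                             (\<forall>i\<in>I. \<forall>j\<in>I. (\<Sum>k\<in>I. N i k * M k j) = (if i = j then 1 else 0)) \<and>
                             (\<forall>i j. i \<notin> I \<or> j \<notin> I \<longrightarrow> N i j = 0))"

end

theory Submission
  imports Defs
begin

text \<open>
  Encode a ranking by bits \<open>W j\<close> (\<open>j\<close> above \<open>m\<close> for \<open>j \<in> X\<close>, \<open>m\<close> above \<open>j\<close> for \<open>j \<in> Y\<close>) and let \<open>N j\<close> be the
  sum of these bits over the voters. The event then reads \<open>N j \<le> k j\<close> for all \<open>j\<close>. Tilting the ranking
  probabilities by \<open>exp (\<tau> \<bullet> W)\<close> makes the mean of \<open>W\<close> equal to the vector of thresholds and its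
  covariance equal to the Hessian, and it turns the probability into \<open>P(\<zeta>)^n \<zeta>^(- k)\<close> times the sum of
  \<open>\<zeta>^(k - a) Pr(N = a)\<close> over all \<open>a \<le> k\<close>. Written as an integral over unit cells, rescaled by \<open>sqrt n\<close> in
  the directions \<open>C\<close>, this sum converges by dominated convergence: the local limit theorem gives the pointwise
  limit, a Gaussian density, and the majorant comes from the bound
  \<open>n^(d/2) Pr(N = a) \<le> K exp (- (\<Sum>j. \<bar>a j - n \<mu> j\<bar>) / sqrt n)\<close>. The geometric directions integrate to
  \<open>1 / (1 - \<zeta> j)\<close> and the directions in \<open>C\<close> to the Gaussian orthant integral.
\<close>

section \<open>Determinants and quadratic forms over finite index sets\<close>

text \<open>The obstacle is the set \<open>C\<close>: where \<zeta> j = 1 the weights give no decay,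
  so about sqrt n lattice layers below the threshold contribute, and a bound of order n^(-d/2) on
  the point probabilities cannot be summed over them. This is why the local limit theorem has to be
  supplemented by a tail bound on the scale sqrt n. Positivity of every ranking probability enters
  through rankings with a prescribed set above m: they make the zero step and each unit step
  possible. Comparing these two steps excludes a proper sublattice and a degenerate covariance at
  once. Determinant and inverse are taken over arbitrary finite index sets, so the matrix facts are
  proved by eliminating one index at a time. The same elimination integrates the Gaussian one
  coordinate at a time.\<close>

lemma det_on_row_linear:
  assumes "finite I" "i \<in> I"
  shows "det_on I (M(i := (\<lambda>j. f j - c * g j))) = det_on I (M(i := f)) - c * det_on I (M(i := g))"
proof -
  have split: "(\<Prod>r\<in>I. (M(i := h)) r (\<pi> r)) = h (\<pi> i) * (\<Prod>r\<in>I - {i}. M r (\<pi> r))" for h \<pi>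
    by (subst prod.remove[OF assms]) (auto intro!: prod.cong)
  show ?thesis
    unfolding det_on_def split by (simp add: sum_distrib_left sum_subtractf algebra_simps)
qed

text \<open>Composition with the transposition of i and k is an involution on the permutations of I
  that preserves each product and reverses each sign.\<close>

lemma det_on_identical_rows:
  assumes "finite I" "i \<in> I" "k \<in> I" "i \<noteq> k" "M i = M k"
  shows "det_on I M = 0"
proof -
  let ?t = "Transposition.transpose i k"
  let ?h = "\<lambda>\<pi>. of_int (sign \<pi>) * (\<Prod>r\<in>I. M r (\<pi> r))"
  have t: "?t permutes I" using assms by (simp add: permutes_swap_id)
  have anti: "?h (\<pi> \<circ> ?t) = - ?h \<pi>" if "\<pi> permutes I" for \<pi>
  proof -
    have "permutation \<pi>" using that assms(1) permutation_permutes by blast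
    then have "sign (\<pi> \<circ> ?t) = - sign \<pi>"
      using assms(4) by (simp add: sign_compose sign_swap_id permutation_swap_id)
    moreover have "(\<Prod>r\<in>I. M r ((\<pi> \<circ> ?t) r)) = (\<Prod>r\<in>I. M (?t r) (\<pi> r))"
      by (rule prod.reindex_bij_witness[of _ ?t ?t])
         (use t in \<open>auto simp: permutes_in_image\<close>)
    moreover have "M (?t r) = M r" for r
      using assms(5) by (cases "r = i"; cases "r = k") simp_all
    ultimately show ?thesis by simp
  qed
  have "det_on I M = (\<Sum>\<pi> \<in> {\<pi>. \<pi> permutes I}. ?h (\<pi> \<circ> ?t))"
    unfolding det_on_def
    by (rule sum.reindex_bij_witness[of _ "\<lambda>\<pi>. \<pi> \<circ> ?t" "\<lambda>\<pi>. \<pi> \<circ> ?t"])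
       (auto simp: o_assoc[symmetric] t permutes_compose)
  also have "\<dots> = - det_on I M"
    unfolding det_on_def by (subst sum_negf[symmetric], rule sum.cong) (simp_all only: mem_Collect_eq anti)
  finally show ?thesis by simp
qed

text \<open>Induction on the set of modified rows: by linearity in the new row, the correction term
  has two rows equal to row k. Row k itself stays unmodified because
  \<open>k \<notin> J\<close>.\<close>

lemma det_on_row_ops:
  assumes "finite I" "finite J" "J \<subseteq> I" "k \<in> I" "k \<notin> J"
  shows "det_on I (\<lambda>r. if r \<in> J then (\<lambda>j. M r j - c r * M k j) else M r) = det_on I M"
  using assms(2,3,5)
proof (induction J rule: finite_induct)
  case empty
  show ?case by simp
next
  case (insert i J)
  let ?M = "\<lambda>J r j. if r \<in> J then M r j - c r * M k j else M r j"
  have eq: "(\<lambda>r. if r \<in> J then (\<lambda>j. M r j - c r * M k j) else M r) = ?M J" for J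
    by auto
  have upd: "?M (insert i J) = (?M J)(i := (\<lambda>j. M i j - c i * M k j))"
    by auto
  have "(?M J)(i := M i) = ?M J" using insert.hyps by auto
  moreover have "det_on I ((?M J)(i := M k)) = 0"
    using insert assms by (intro det_on_identical_rows[of I i k]) auto
  ultimately have "det_on I (?M (insert i J)) = det_on I (?M J)"
    unfolding upd using insert.prems by (subst det_on_row_linear[OF assms(1)]) auto
  then show ?case using insert unfolding eq by simp
qed

lemma det_on_cong: "(\<And>i j. i \<in> I \<Longrightarrow> j \<in> I \<Longrightarrow> M i j = N i j) \<Longrightarrow> det_on I M = det_on I N"
  unfolding det_on_def by (auto intro!: sum.cong prod.cong simp: permutes_in_image)

text \<open>A permutation that moves k sends some r in I to k and so picks up an entry of the
  vanishing column; those that fix k are the permutations of I.\<close>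

lemma det_on_expand_column:
  assumes "finite I" "k \<notin> I" "\<And>r. r \<in> I \<Longrightarrow> M r k = 0"
  shows "det_on (insert k I) M = M k k * det_on I M"
proof -
  let ?K = "insert k I"
  let ?h = "\<lambda>\<pi>. of_int (sign \<pi>) * (\<Prod>r\<in>?K. M r (\<pi> r))"
  have "det_on ?K M = (\<Sum>\<pi> \<in> {\<pi>. \<pi> permutes I}. ?h \<pi>)"
    unfolding det_on_def
  proof (rule sum.mono_neutral_right)
    show "\<forall>\<pi>\<in>{\<pi>. \<pi> permutes ?K} - {\<pi>. \<pi> permutes I}. ?h \<pi> = 0"
    proof
      fix \<pi> assume \<pi>: "\<pi> \<in> {\<pi>. \<pi> permutes ?K} - {\<pi>. \<pi> permutes I}"
      then have perm: "\<pi> permutes ?K" and nperm: "\<not> \<pi> permutes I" by auto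
      have "\<pi> k \<noteq> k"
        using permutes_superset[OF perm, of I] nperm by auto
      moreover obtain r where "r \<in> ?K" "\<pi> r = k"
        using permutes_image[OF perm] by (metis imageE insertI1)
      ultimately have "r \<in> I" "\<pi> r = k" by auto
      then have "(\<Prod>r\<in>?K. M r (\<pi> r)) = 0"
        using assms by (intro prod_zero) auto
      then show "?h \<pi> = 0" by simp
    qed
    show "finite {\<pi>. \<pi> permutes ?K}" using assms by (simp add: finite_permutations)
    show "{\<pi>. \<pi> permutes I} \<subseteq> {\<pi>. \<pi> permutes ?K}"
      using permutes_subset[of _ I ?K] by auto
  qed
  also have "\<dots> = M k k * det_on I M"
    unfolding det_on_def sum_distrib_left using assms
    by (intro sum.cong) (auto simp: permutes_not_in)
  finally show ?thesis .
qed

text \<open>Schur complement of the pivot \<open>M k k\<close>: what remains of determinants, linear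
  systems and quadratic forms once the index k is eliminated. It drives the inductions on the index
  set below.\<close>

definition schur :: "nat \<Rightarrow> (nat \<Rightarrow> nat \<Rightarrow> real) \<Rightarrow> nat \<Rightarrow> nat \<Rightarrow> real" where
  "schur k M i j = M i j - M i k / M k k * M k j"

lemma det_on_schur:
  assumes "finite I" "k \<notin> I" "M k k \<noteq> 0"
  shows "det_on (insert k I) M = M k k * det_on I (schur k M)"
proof -
  let ?M = "\<lambda>r. if r \<in> I then (\<lambda>j. M r j - M r k / M k k * M k j) else M r"
  have "det_on (insert k I) M = det_on (insert k I) ?M"
    using assms by (intro det_on_row_ops[symmetric]) auto
  also have "\<dots> = ?M k k * det_on I ?M"
    using assms by (intro det_on_expand_column) auto
  also have "det_on I ?M = det_on I (schur k M)"
    by (rule det_on_cong) (auto simp: schur_def)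
  finally show ?thesis using assms by simp
qed

section \<open>Quadratic forms and positive definite matrices\<close>

definition qform :: "nat set \<Rightarrow> (nat \<Rightarrow> nat \<Rightarrow> real) \<Rightarrow> (nat \<Rightarrow> real) \<Rightarrow> real" where
  "qform I M x = (\<Sum>i\<in>I. \<Sum>j\<in>I. x i * M i j * x j)"

text \<open>Positive definiteness with an explicit constant: c passes unchanged to Schur complements
  and gives an integrable Gaussian majorant.\<close>

definition sym_coercive :: "nat set \<Rightarrow> real \<Rightarrow> (nat \<Rightarrow> nat \<Rightarrow> real) \<Rightarrow> bool" where
  "sym_coercive I c M \<longleftrightarrow> c > 0 \<and> (\<forall>i\<in>I. \<forall>j\<in>I. M i j = M j i)
     \<and> (\<forall>x. c * (\<Sum>i\<in>I. (x i)\<^sup>2) \<le> qform I M x)"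

lemma sym_coerciveD:
  assumes "sym_coercive I c M"
  shows "c > 0" "i \<in> I \<Longrightarrow> j \<in> I \<Longrightarrow> M i j = M j i" "c * (\<Sum>i\<in>I. (x i)\<^sup>2) \<le> qform I M x"
  using assms by (auto simp: sym_coercive_def)

text \<open>Completing the square in the variable \<open>x k\<close>.\<close>

lemma qform_insert:
  assumes "finite I" "k \<notin> I" "M k k \<noteq> 0" "\<And>i. i \<in> I \<Longrightarrow> M i k = M k i"
  shows "qform (insert k I) M x =
    M k k * (x k + (\<Sum>j\<in>I. M k j * x j) / M k k)\<^sup>2 + qform I (schur k M) x"
proof -
  let ?b = "\<Sum>j\<in>I. M k j * x j"
  have "qform (insert k I) M x = x k * M k k * x k + x k * ?b + x k * ?b + qform I M x"
    unfolding qform_def using assms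
    by (simp add: sum.distrib sum_distrib_left algebra_simps)
  moreover have "qform I (schur k M) x = qform I M x - ?b * ?b / M k k"
    unfolding qform_def schur_def using assms
    by (simp add: sum_subtractf sum_divide_distrib sum_product algebra_simps)
  moreover have "M k k * (x k + ?b / M k k)\<^sup>2 = x k * M k k * x k + x k * ?b + x k * ?b + ?b * ?b / M k k"
    using assms(3) by (simp add: power2_eq_square field_simps)
  ultimately show ?thesis by simp
qed

lemma qform_cong: "(\<And>i. i \<in> I \<Longrightarrow> x i = y i) \<Longrightarrow> qform I M x = qform I M y"
  unfolding qform_def by (auto intro!: sum.cong)

lemma sym_coercive_diag:
  assumes "sym_coercive I c M" "finite I" "k \<in> I"
  shows "M k k \<ge> c"
proof -
  let ?x = "\<lambda>i. if i = k then 1 else 0 :: real"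
  have "(\<Sum>i\<in>I. (?x i)\<^sup>2) = (\<Sum>i\<in>I. ?x i)" by (intro sum.cong) auto
  then have "(\<Sum>i\<in>I. (?x i)\<^sup>2) = 1" using assms by simp
  moreover have "qform I M ?x = (\<Sum>i\<in>I. ?x i * (\<Sum>j\<in>I. M i j * ?x j))"
    unfolding qform_def by (simp add: sum_distrib_left mult.assoc)
  then have "qform I M ?x = M k k" using assms by (simp add: if_distrib[of "\<lambda>x. _ * x"] if_distrib[of "\<lambda>x. x * _"] cong: if_cong)
  ultimately show ?thesis using sym_coerciveD(3)[OF assms(1), of ?x] by simp
qed

text \<open>Choose the coordinate at k so that the square in \<open>qform_insert\<close> vanishes:
  the two forms then agree, and the extra coordinate can only enlarge the sum of squares.\<close>

lemma sym_coercive_schur: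
  assumes "sym_coercive (insert k I) c M" "finite I" "k \<notin> I"
  shows "sym_coercive I c (schur k M)"
proof -
  note D = sym_coerciveD[OF assms(1)]
  have pos: "M k k > 0" using sym_coercive_diag[OF assms(1), of k] D(1) assms by simp
  have "c * (\<Sum>i\<in>I. (x i)\<^sup>2) \<le> qform I (schur k M) x" for x
  proof -
    define y where "y = x(k := - (\<Sum>j\<in>I. M k j * x j) / M k k)"
    have yx: "y i = x i" if "i \<in> I" for i using that assms by (auto simp: y_def)
    have "(\<Sum>j\<in>I. M k j * y j) = (\<Sum>j\<in>I. M k j * x j)" by (intro sum.cong) (auto simp: yx)
    then have "qform (insert k I) M y = qform I (schur k M) y"
      using assms pos D(2) by (subst qform_insert) (auto simp: y_def)
    also have "\<dots> = qform I (schur k M) x" by (rule qform_cong) (rule yx)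
    finally have "qform (insert k I) M y = qform I (schur k M) x" .
    moreover have "(\<Sum>i\<in>I. (x i)\<^sup>2) = (\<Sum>i\<in>I. (y i)\<^sup>2)" by (intro sum.cong) (auto simp: yx)
    then have "(\<Sum>i\<in>I. (x i)\<^sup>2) \<le> (\<Sum>i\<in>insert k I. (y i)\<^sup>2)" using assms by simp
    then have "c * (\<Sum>i\<in>I. (x i)\<^sup>2) \<le> c * (\<Sum>i\<in>insert k I. (y i)\<^sup>2)"
      using D(1) by (intro mult_left_mono) auto
    ultimately show ?thesis using D(3)[of y] by linarith
  qed
  moreover have "schur k M i j = schur k M j i" if "i \<in> I" "j \<in> I" for i j
    using D(2)[of i j] D(2)[of i k] D(2)[of j k] that by (simp add: schur_def)
  ultimately show ?thesis using D(1) unfolding sym_coercive_def by blast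
qed

lemma sym_coercive_det_pos:
  assumes "finite I" "sym_coercive I c M"
  shows "det_on I M > 0"
  using assms
proof (induction I arbitrary: M rule: finite_induct)
  case empty
  have "{\<pi>::nat\<Rightarrow>nat. \<pi> permutes {}} = {id}" by auto
  then show ?case by (simp add: det_on_def)
next
  case (insert k I)
  have "M k k > 0" using sym_coercive_diag[of "insert k I" c M k] sym_coerciveD(1)[OF insert.prems] insert by simp
  then show ?case using insert.IH[OF sym_coercive_schur[OF insert.prems]] insert.hyps
    by (simp add: det_on_schur)
qed

lemma schur_solution:
  assumes "finite I" "k \<notin> I" "M k k \<noteq> 0"
    and "\<And>i. i \<in> insert k I \<Longrightarrow> (\<Sum>j\<in>insert k I. M i j * y j) = \<xi> i"
  shows "i \<in> I \<Longrightarrow> (\<Sum>j\<in>I. schur k M i j * y j) = \<xi> i - M i k / M k k * \<xi> k"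
    and "y k = (\<xi> k - (\<Sum>j\<in>I. M k j * y j)) / M k k"
proof -
  have k: "M k k * y k + (\<Sum>j\<in>I. M k j * y j) = \<xi> k" using assms(4)[of k] assms by simp
  then show "y k = (\<xi> k - (\<Sum>j\<in>I. M k j * y j)) / M k k" using assms(3) by (simp add: field_simps)
  assume "i \<in> I"
  then have i: "M i k * y k + (\<Sum>j\<in>I. M i j * y j) = \<xi> i" using assms(4)[of i] assms by simp
  have "(\<Sum>j\<in>I. schur k M i j * y j) = (\<Sum>j\<in>I. M i j * y j) - M i k / M k k * (\<Sum>j\<in>I. M k j * y j)"
    by (simp add: schur_def sum_subtractf sum_distrib_left algebra_simps)
  then show "(\<Sum>j\<in>I. schur k M i j * y j) = \<xi> i - M i k / M k k * \<xi> k"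
    unfolding k[symmetric] i[symmetric] using assms(3) by (simp add: field_simps)
qed

section \<open>Linear systems and the inverse matrix\<close>

lemma sym_coercive_solution:
  assumes "finite I" "sym_coercive I c M"
  shows "\<exists>y. \<forall>i\<in>I. (\<Sum>j\<in>I. M i j * y j) = \<xi> i"
  using assms
proof (induction I arbitrary: M \<xi> rule: finite_induct)
  case empty
  show ?case by simp
next
  case (insert k I)
  have pos: "M k k > 0" using sym_coercive_diag[of "insert k I" c M k] sym_coerciveD(1)[OF insert.prems] insert by simp
  obtain y where y: "\<forall>i\<in>I. (\<Sum>j\<in>I. schur k M i j * y j) = \<xi> i - M i k / M k k * \<xi> k"
    using insert.IH[OF sym_coercive_schur[OF insert.prems], of "\<lambda>i. \<xi> i - M i k / M k k * \<xi> k"] insert.hyps by auto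
  \<comment> \<open>Back substitution: once the eliminated system is solved, row k dictates the
    coordinate at k.\<close>
  define z where "z = y(k := (\<xi> k - (\<Sum>j\<in>I. M k j * y j)) / M k k)"
  have zs: "(\<Sum>j\<in>I. N j * z j) = (\<Sum>j\<in>I. N j * y j)" for N
    using insert.hyps by (intro sum.cong) (auto simp: z_def)
  have zk: "z k = (\<xi> k - (\<Sum>j\<in>I. M k j * y j)) / M k k" by (simp add: z_def)
  have "(\<Sum>j\<in>insert k I. M i j * z j) = \<xi> i" if "i \<in> insert k I" for i
  proof (cases "i = k")
    case True
    then show ?thesis using insert.hyps pos by (simp add: zs zk)
  next
    case False
    then have "\<xi> i - M i k / M k k * \<xi> k = (\<Sum>j\<in>I. schur k M i j * y j)" using y that by auto
    also have "\<dots> = (\<Sum>j\<in>I. M i j * y j) - M i k / M k k * (\<Sum>j\<in>I. M k j * y j)"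
      by (simp add: schur_def sum_subtractf sum_distrib_left algebra_simps)
    finally have "\<xi> i = M i k * z k + (\<Sum>j\<in>I. M i j * y j)"
      using pos by (simp add: zk field_simps)
    then show ?thesis using insert.hyps by (simp add: zs)
  qed
  then show ?case by blast
qed

text \<open>\<open>inverse_on\<close> is a definite description, so existence and uniqueness both
  have to be established. Solving for each unit vector gives a right inverse \<open>N\<close>; since
  \<open>M\<close> is symmetric, the transpose of \<open>N\<close> is a left inverse, hence
  \<open>N\<close> is symmetric and two-sided.\<close>

lemma inverse_on_right:
  assumes "finite I" "sym_coercive I c M" "i \<in> I" "j \<in> I"
  shows "(\<Sum>k\<in>I. M i k * inverse_on I M k j) = (if i = j then 1 else 0)"
proof -
  let ?P = "\<lambda>N. (\<forall>i\<in>I. \<forall>j\<in>I. (\<Sum>k\<in>I. M i k * N k j) = (if i = j then 1 else 0 :: real)) \<and>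
     (\<forall>i\<in>I. \<forall>j\<in>I. (\<Sum>k\<in>I. N i k * M k j) = (if i = j then 1 else 0)) \<and>
     (\<forall>i j. i \<notin> I \<or> j \<notin> I \<longrightarrow> N i j = 0)"
  obtain Y where Y: "\<And>j i. i \<in> I \<Longrightarrow> (\<Sum>k\<in>I. M i k * Y j k) = (if i = j then 1 else 0)"
    using sym_coercive_solution[OF assms(1,2), of "\<lambda>i. if i = _ then 1 else 0"] by metis
  define N where "N = (\<lambda>i j. if i \<in> I \<and> j \<in> I then Y j i else 0)"
  have right: "(\<Sum>k\<in>I. M i k * N k j) = (if i = j then 1 else 0)" if "i \<in> I" "j \<in> I" for i j
    using Y[OF that(1), of j] that by (simp add: N_def)
  have symM: "M i j = M j i" if "i \<in> I" "j \<in> I" for i j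
    using sym_coerciveD(2)[OF assms(2)] that by blast
  have left': "(\<Sum>k\<in>I. N k i * M k j) = (if i = j then 1 else 0)" if "i \<in> I" "j \<in> I" for i j
  proof -
    have "(\<Sum>k\<in>I. N k i * M k j) = (\<Sum>k\<in>I. M j k * N k i)"
      using that symM by (intro sum.cong) auto
    then show ?thesis using right that by auto
  qed
  have symN: "N i j = N j i" if "i \<in> I" "j \<in> I" for i j
  proof -
    have "N i j = (\<Sum>l\<in>I. (if i = l then 1 else 0) * N l j)"
      using assms(1) that by (simp add: if_distrib[of "\<lambda>x. x * _"] cong: if_cong)
    also have "\<dots> = (\<Sum>l\<in>I. (\<Sum>k\<in>I. N k i * M k l) * N l j)"
      using that by (intro sum.cong) (auto simp: left')
    also have "\<dots> = (\<Sum>k\<in>I. N k i * (\<Sum>l\<in>I. M k l * N l j))"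
      unfolding sum_distrib_right sum_distrib_left by (subst sum.swap) (simp add: mult.assoc)
    also have "\<dots> = (\<Sum>k\<in>I. N k i * (if k = j then 1 else 0))"
      using that by (intro sum.cong) (auto simp: right)
    also have "\<dots> = N j i" using assms(1) that by (simp add: if_distrib[of "\<lambda>x. _ * x"] cong: if_cong)
    finally show ?thesis .
  qed
  have "?P N"
  proof (intro conjI ballI)
    fix i j assume ij: "i \<in> I" "j \<in> I"
    show "(\<Sum>k\<in>I. M i k * N k j) = (if i = j then 1 else 0)" by (rule right[OF ij])
    have "(\<Sum>k\<in>I. N i k * M k j) = (\<Sum>k\<in>I. N k i * M k j)"
      using ij symN by (intro sum.cong) auto
    then show "(\<Sum>k\<in>I. N i k * M k j) = (if i = j then 1 else 0)" using left'[OF ij] by simp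
  qed (simp add: N_def)
  moreover have "N' = N" if "?P N'" for N'
  proof (intro ext)
    fix i j
    show "N' i j = N i j"
    proof (cases "i \<in> I \<and> j \<in> I")
      case True
      then have "N' i j = (\<Sum>l\<in>I. N' i l * (if l = j then 1 else 0))"
        using assms(1) by (simp add: if_distrib[of "\<lambda>x. _ * x"] cong: if_cong)
      also have "\<dots> = (\<Sum>l\<in>I. N' i l * (\<Sum>k\<in>I. M l k * N k j))"
        using True by (intro sum.cong) (auto simp: right)
      also have "\<dots> = (\<Sum>k\<in>I. (\<Sum>l\<in>I. N' i l * M l k) * N k j)"
        unfolding sum_distrib_right sum_distrib_left by (subst sum.swap) (simp add: mult.assoc)
      also have "\<dots> = (\<Sum>k\<in>I. (if i = k then 1 else 0) * N k j)"
        using True that by (intro sum.cong) auto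
      also have "\<dots> = N i j" using assms(1) True by (simp add: if_distrib[of "\<lambda>x. x * _"] cong: if_cong)
      finally show ?thesis .
    next
      case False
      then show ?thesis using that by (auto simp: N_def)
    qed
  qed
  ultimately have "?P (THE N. ?P N)" by (rule theI)
  then show ?thesis using assms(3,4) unfolding inverse_on_def by blast
qed

section \<open>Gaussian Fourier integrals\<close>

text \<open>The shift \<open>h\<close> is what completing the square in one coordinate leaves
  behind. In \<open>gaussian_char_PiM\<close> it is linear in the other coordinates, so it only
  changes their frequencies.\<close>

lemma gaussian_shift_char:
  fixes a h \<xi> :: real
  assumes a: "a > 0"
  shows "(\<integral>s. of_real (exp (- a * (s + h)\<^sup>2 / 2)) * iexp (\<xi> * s) \<partial>lborel) =
    of_real (sqrt (2 * pi / a) * exp (- \<xi>\<^sup>2 / (2 * a))) * iexp (- \<xi> * h)"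
proof -
  have "(\<integral>s. of_real (exp (- a * (s + h)\<^sup>2 / 2)) * iexp (\<xi> * s) \<partial>lborel)
      = (1 / sqrt a) *\<^sub>R (\<integral>x. of_real (exp (- a * ((- h + 1 / sqrt a * x) + h)\<^sup>2 / 2)) * iexp (\<xi> * (- h + 1 / sqrt a * x)) \<partial>lborel)"
    using a by (subst lborel_integral_real_affine[where c = "1 / sqrt a" and t = "- h"]) auto
  also have "(\<lambda>x. of_real (exp (- a * ((- h + 1 / sqrt a * x) + h)\<^sup>2 / 2)) * iexp (\<xi> * (- h + 1 / sqrt a * x)))
      = (\<lambda>x. (of_real (sqrt (2 * pi)) * iexp (- \<xi> * h)) * (std_normal_density x *\<^sub>R iexp (\<xi> / sqrt a * x)))"
  proof
    fix x
    have "a * ((- h + 1 / sqrt a * x) + h)\<^sup>2 = x\<^sup>2"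
      using a by (simp add: power_divide)
    moreover have "iexp (\<xi> * (- h + 1 / sqrt a * x)) = iexp (- \<xi> * h) * iexp (\<xi> / sqrt a * x)"
      unfolding exp_add[symmetric] by (simp add: algebra_simps)
    moreover have "exp (- x\<^sup>2 / 2) = sqrt (2 * pi) * std_normal_density x"
      by (simp add: std_normal_density_def)
    ultimately show "of_real (exp (- a * ((- h + 1 / sqrt a * x) + h)\<^sup>2 / 2)) * iexp (\<xi> * (- h + 1 / sqrt a * x))
       = (of_real (sqrt (2 * pi)) * iexp (- \<xi> * h)) * (std_normal_density x *\<^sub>R iexp (\<xi> / sqrt a * x))"
      by (simp add: scaleR_conv_of_real mult_ac)
  qed
  also have "(\<integral>x. (of_real (sqrt (2 * pi)) * iexp (- \<xi> * h)) * (std_normal_density x *\<^sub>R iexp (\<xi> / sqrt a * x)) \<partial>lborel)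
     = (of_real (sqrt (2 * pi)) * iexp (- \<xi> * h)) * char std_normal_distribution (\<xi> / sqrt a)"
    unfolding char_def integral_mult_right_zero by (simp add: integral_density)
  also have "char std_normal_distribution (\<xi> / sqrt a) = of_real (exp (- \<xi>\<^sup>2 / (2 * a)))"
    using a by (simp add: char_std_normal_distribution power_divide)
  finally show ?thesis
    using a by (simp add: real_sqrt_divide scaleR_conv_of_real mult_ac)
qed

interpretation lborel_product: product_sigma_finite "\<lambda>_. lborel :: real measure"
  by standard

lemma integrable_gaussian_1d:
  assumes "c > 0"
  shows "integrable lborel (\<lambda>s. exp (- c * s\<^sup>2) :: real)"
proof -
  have "integrable lborel (\<lambda>x. std_normal_density (0 + sqrt (2 * c) * x))"
    using assms by (subst lborel_integrable_real_affine_iff) auto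
  then have "integrable lborel (\<lambda>x. sqrt (2 * pi) * std_normal_density (0 + sqrt (2 * c) * x))"
    by (rule integrable_mult_right)
  then show ?thesis using assms by (simp add: std_normal_density_def power_mult_distrib)
qed

lemma integrable_gaussian_PiM:
  fixes I :: "nat set" and c :: real
  assumes "finite I" "c > 0"
  shows "integrable (PiM I (\<lambda>_. lborel)) (\<lambda>s. exp (- c * (\<Sum>i\<in>I. (s i)\<^sup>2)))"
proof -
  have "integrable (PiM I (\<lambda>_. lborel)) (\<lambda>s. \<Prod>i\<in>I. exp (- c * (s i)\<^sup>2))"
    using assms by (intro lborel_product.product_integrable_prod integrable_gaussian_1d) auto
  then show ?thesis using assms(1) by (simp add: sum_distrib_left flip: sum_negf exp_sum)
qed

lemma integrable_gaussian_char:
  fixes I :: "nat set"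
  assumes "finite I" "sym_coercive I c M"
  shows "integrable (PiM I (\<lambda>_. lborel))
    (\<lambda>s. of_real (exp (- qform I M s / 2)) * iexp (\<Sum>i\<in>I. \<xi> i * s i))"
proof (rule Bochner_Integration.integrable_bound[OF integrable_gaussian_PiM[of I "c / 2"]])
  show "finite I" "c / 2 > 0" using assms sym_coerciveD(1) by auto
  show "(\<lambda>s. of_real (exp (- qform I M s / 2)) * iexp (\<Sum>i\<in>I. \<xi> i * s i))
    \<in> borel_measurable (PiM I (\<lambda>_. lborel))"
    unfolding qform_def by measurable
  show "AE s in PiM I (\<lambda>_. lborel). norm (of_real (exp (- qform I M s / 2)) * iexp (\<Sum>i\<in>I. \<xi> i * s i))
        \<le> norm (exp (- (c / 2) * (\<Sum>i\<in>I. (s i)\<^sup>2)))"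
  proof (rule AE_I2)
    fix s
    show "norm (of_real (exp (- qform I M s / 2)) * iexp (\<Sum>i\<in>I. \<xi> i * s i))
        \<le> norm (exp (- (c / 2) * (\<Sum>i\<in>I. (s i)\<^sup>2)))"
      using sym_coerciveD(3)[OF assms(2), of s] by (simp add: norm_mult)
  qed
qed

text \<open>The exponent is expressed by a solution \<open>y\<close> of the linear system, which
  keeps inverse matrices out of the induction. Integrating out coordinate k replaces \<xi> by the
  right-hand side of the eliminated system, which \<open>y\<close> still solves.\<close>

lemma gaussian_char_PiM:
  fixes I :: "nat set" and \<xi> y :: "nat \<Rightarrow> real"
  assumes "finite I" "sym_coercive I c M"
    and "\<And>i. i \<in> I \<Longrightarrow> (\<Sum>j\<in>I. M i j * y j) = \<xi> i"
  shows "(\<integral>s. of_real (exp (- qform I M s / 2)) * iexp (\<Sum>i\<in>I. \<xi> i * s i) \<partial>PiM I (\<lambda>_. lborel))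
    = of_real (sqrt ((2 * pi) ^ card I / det_on I M) * exp (- (\<Sum>i\<in>I. \<xi> i * y i) / 2))"
  using assms
proof (induction I arbitrary: M \<xi> rule: finite_induct)
  case empty
  have "{\<pi>::nat\<Rightarrow>nat. \<pi> permutes {}} = {id}" by auto
  then show ?case by (simp add: det_on_def qform_def PiM_empty lebesgue_integral_count_space_finite)
next
  case (insert k I)
  let ?a = "M k k"
  define \<xi>' where "\<xi>' = (\<lambda>i. \<xi> i - M i k / ?a * \<xi> k)"
  have pos: "?a > 0" using sym_coercive_diag[of "insert k I" c M k] sym_coerciveD(1)[OF insert.prems(1)] insert by simp
  have symM: "M i k = M k i" if "i \<in> I" for i
    using sym_coerciveD(2)[OF insert.prems(1)] that by blast
  note sc = sym_coercive_schur[OF insert.prems(1) insert.hyps]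
  note sol = schur_solution[where M = M and k = k and I = I and y = y and \<xi> = \<xi>, OF insert.hyps _ insert.prems(2)]
  have IH: "(\<integral>s. of_real (exp (- qform I (schur k M) s / 2)) * iexp (\<Sum>i\<in>I. \<xi>' i * s i) \<partial>PiM I (\<lambda>_. lborel))
    = of_real (sqrt ((2 * pi) ^ card I / det_on I (schur k M)) * exp (- (\<Sum>i\<in>I. \<xi>' i * y i) / 2))"
    by (rule insert.IH[OF sc]) (use sol(1) pos in \<open>auto simp: \<xi>'_def\<close>)
  have detp: "det_on I (schur k M) > 0" by (rule sym_coercive_det_pos[OF insert.hyps(1) sc])
  let ?f = "\<lambda>s. complex_of_real (exp (- qform (insert k I) M s / 2)) * iexp (\<Sum>i\<in>insert k I. \<xi> i * s i)"
  let ?h = "\<lambda>s. (\<Sum>j\<in>I. M k j * s j) / ?a"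
  let ?K = "sqrt (2 * pi / ?a) * exp (- (\<xi> k)\<^sup>2 / (2 * ?a))"
  have step: "(\<integral>t. ?f (s(k := t)) \<partial>lborel) =
      of_real ?K * (of_real (exp (- qform I (schur k M) s / 2)) * iexp (\<Sum>i\<in>I. \<xi>' i * s i))" for s
  proof -
    have fs: "?f (s(k := t)) = (of_real (exp (- qform I (schur k M) s / 2)) * iexp (\<Sum>i\<in>I. \<xi> i * s i)) *
          (of_real (exp (- ?a * (t + ?h s)\<^sup>2 / 2)) * iexp (\<xi> k * t))" for t
    proof -
      have a: "(\<Sum>j\<in>I. N j * (s(k := t)) j) = (\<Sum>j\<in>I. N j * s j)" for N
        using insert.hyps by (intro sum.cong) auto
      have "qform I (schur k M) (s(k := t)) = qform I (schur k M) s"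
        using insert.hyps by (intro qform_cong) auto
      then have "qform (insert k I) M (s(k := t)) = ?a * (t + ?h s)\<^sup>2 + qform I (schur k M) s"
        using pos insert.hyps symM by (subst qform_insert) (simp_all add: a del: fun_upd_apply, simp)

      then have q: "exp (- qform (insert k I) M (s(k := t)) / 2)
          = exp (- qform I (schur k M) s / 2) * exp (- ?a * (t + ?h s)\<^sup>2 / 2)"
        by (simp add: add_divide_distrib diff_divide_distrib flip: exp_add)
      have l: "(\<Sum>i\<in>insert k I. \<xi> i * (s(k := t)) i) = (\<Sum>i\<in>I. \<xi> i * s i) + \<xi> k * t"
        using insert.hyps a[of \<xi>] by simp
      show ?thesis
        unfolding q l of_real_add ring_distribs exp_add of_real_mult by (simp only: mult_ac)
    qed
    have "(\<Sum>i\<in>I. \<xi>' i * s i) = (\<Sum>i\<in>I. \<xi> i * s i) + - \<xi> k * ?h s"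
      using symM by (simp add: \<xi>'_def algebra_simps sum_subtractf sum_negf sum_distrib_left sum_divide_distrib)
    then have "iexp (\<Sum>i\<in>I. \<xi>' i * s i) = iexp (\<Sum>i\<in>I. \<xi> i * s i) * iexp (- \<xi> k * ?h s)"
      unfolding exp_add[symmetric] by (simp add: ring_distribs)
    then show ?thesis unfolding fs integral_mult_right_zero gaussian_shift_char[OF pos]
      by (simp add: mult_ac)
  qed
  have "(\<integral>s. ?f s \<partial>PiM (insert k I) (\<lambda>_. lborel)) = (\<integral>s. (\<integral>t. ?f (s(k := t)) \<partial>lborel) \<partial>PiM I (\<lambda>_. lborel))"
    by (rule lborel_product.product_integral_insert[OF insert.hyps])
       (rule integrable_gaussian_char[OF _ insert.prems(1)], use insert in simp)
  also have "\<dots> = of_real ?K * of_real (sqrt ((2 * pi) ^ card I / det_on I (schur k M)) * exp (- (\<Sum>i\<in>I. \<xi>' i * y i) / 2))"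
    unfolding step integral_mult_right_zero IH ..
  also have "\<dots> = of_real ((sqrt (2 * pi / ?a) * sqrt ((2 * pi) ^ card I / det_on I (schur k M)))
      * (exp (- (\<xi> k)\<^sup>2 / (2 * ?a)) * exp (- (\<Sum>i\<in>I. \<xi>' i * y i) / 2)))"
    by simp
  also have "sqrt (2 * pi / ?a) * sqrt ((2 * pi) ^ card I / det_on I (schur k M))
      = sqrt ((2 * pi) ^ card (insert k I) / det_on (insert k I) M)"
    using insert.hyps pos by (simp add: det_on_schur flip: real_sqrt_mult)
  also have "exp (- (\<xi> k)\<^sup>2 / (2 * ?a)) * exp (- (\<Sum>i\<in>I. \<xi>' i * y i) / 2)
     = exp (- (\<Sum>i\<in>insert k I. \<xi> i * y i) / 2)"
  proof -
    have "(\<Sum>i\<in>I. \<xi>' i * y i) = (\<Sum>i\<in>I. \<xi> i * y i) - \<xi> k / ?a * (\<Sum>j\<in>I. M k j * y j)"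
      using symM by (simp add: \<xi>'_def algebra_simps sum_subtractf sum_distrib_left sum_divide_distrib)
    moreover have "(\<Sum>i\<in>insert k I. \<xi> i * y i) = \<xi> k * y k + (\<Sum>i\<in>I. \<xi> i * y i)"
      using insert.hyps by simp
    moreover have "\<xi> k * y k = (\<xi> k)\<^sup>2 / ?a - \<xi> k / ?a * (\<Sum>j\<in>I. M k j * y j)"
      by (subst sol(2)) (use pos in \<open>simp_all add: power2_eq_square diff_divide_distrib right_diff_distrib\<close>)
    ultimately have "(\<xi> k)\<^sup>2 / ?a + (\<Sum>i\<in>I. \<xi>' i * y i) = (\<Sum>i\<in>insert k I. \<xi> i * y i)" by simp
    then have "- (\<xi> k)\<^sup>2 / (2 * ?a) + - (\<Sum>i\<in>I. \<xi>' i * y i) / 2 = - (\<Sum>i\<in>insert k I. \<xi> i * y i) / 2"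
      by (simp add: field_simps)
    then show ?thesis by (simp flip: exp_add)
  qed
  finally show ?case .
qed

section \<open>Lattice walks and their characteristic functions\<close>

text \<open>The Taylor error u^4/24 is at most u^2/6 because u^2 is at most 4, and 1/2 - 1/6 =
  1/3.\<close>

lemma cos_le_quadratic:
  fixes u :: real
  assumes "\<bar>u\<bar> \<le> 2"
  shows "cos u \<le> 1 - u\<^sup>2 / 3"
proof -
  have "\<bar>Re (iexp u - (\<Sum>k\<le>3. (\<i> * of_real u) ^ k / fact k))\<bar> \<le> \<bar>u\<bar> ^ 4 / 24"
    using order_trans[OF abs_Re_le_cmod iexp_approx1[of u 3]] by (simp add: fact_numeral)
  moreover have "Re (\<Sum>k\<le>3. (\<i> * of_real u) ^ k / fact k) = 1 - u\<^sup>2 / 2"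
    by (simp add: numeral_3_eq_3 power2_eq_square)
  ultimately have "\<bar>cos u - (1 - u\<^sup>2 / 2)\<bar> \<le> u ^ 4 / 24"
    by (simp add: Re_exp)
  then have "cos u \<le> 1 - u\<^sup>2 / 2 + u ^ 4 / 24" by linarith
  moreover have "u\<^sup>2 \<le> 2\<^sup>2" using assms by (intro abs_le_square_iff[THEN iffD1]) simp
  then have "u\<^sup>2 * u\<^sup>2 \<le> 4 * u\<^sup>2" by (intro mult_right_mono) auto
  then have "u ^ 4 \<le> 4 * u\<^sup>2" by (simp add: power4_eq_xxxx power2_eq_square mult.assoc)
  ultimately show ?thesis by simp
qed

text \<open>The norm is 2 cos (t/2). It measures the cancellation in a characteristic function
  between two outcomes that differ by one unit step.\<close>

lemma norm_one_plus_iexp: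
  fixes t :: real
  assumes "\<bar>t\<bar> \<le> pi"
  shows "norm (1 + iexp t) \<le> 2 - t\<^sup>2 / 6"
proof -
  have "1 + iexp t = iexp (t / 2) * (iexp (- (t / 2)) + iexp (t / 2))"
    unfolding ring_distribs exp_add[symmetric] by simp
  also have "iexp (- (t / 2)) + iexp (t / 2) = of_real (2 * cos (t / 2))"
    by (simp add: complex_eq_iff Re_exp Im_exp)
  finally have "norm (1 + iexp t) = \<bar>2 * cos (t / 2)\<bar>" by (simp only: norm_mult norm_exp_i_times norm_of_real mult_1)
  moreover have "cos (t / 2) \<ge> 0" using assms by (intro cos_ge_zero) auto
  moreover have "cos (t / 2) \<le> 1 - (t / 2)\<^sup>2 / 3"
    using assms pi_less_4 by (intro cos_le_quadratic) auto
  ultimately show ?thesis by (simp add: power_divide)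
qed

text \<open>Orthogonality of characters on a stretched period. With \<open>L\<close> equal to sqrt n
  it gives Fourier inversion directly in the variables of the central limit scaling.\<close>

lemma integral_iexp_period:
  fixes L :: real and k :: int
  assumes "L > 0"
  shows "(\<integral>x. indicator {- (pi * L)..pi * L} x *\<^sub>R iexp (x * (k / L)) \<partial>lborel) = (if k = 0 then of_real (2 * pi * L) else 0)"
proof (cases "k = 0")
  case True
  have "(\<integral>x. indicator {- (pi * L)..pi * L} x *\<^sub>R (1 :: complex) \<partial>lborel) = measure lborel {- (pi * L)..pi * L} *\<^sub>R 1"
    using assms by simp
  then show ?thesis using True assms by (simp add: scaleR_conv_of_real)
next
  case False
  define F where "F = (\<lambda>x::real. iexp (x * (k / L)) * (L / (\<i> * of_int k)))"
  have "(\<integral>x. indicator {- (pi * L)..pi * L} x *\<^sub>R iexp (x * (k / L)) \<partial>lborel) = F (pi * L) - F (- (pi * L))"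
  proof (rule integral_FTC_Icc)
    show "- (pi * L) \<le> pi * L" using assms by simp
    fix x :: real
    show "(F has_vector_derivative iexp (x * (k / L))) (at x within {- (pi * L)..pi * L})"
      unfolding F_def using False assms
      by (auto intro!: derivative_eq_intros has_vector_derivative_real_field simp: field_simps)
  qed (use assms in \<open>auto intro!: continuous_intros\<close>)
  also have "\<dots> = 0"
  proof -
    have "pi * L * (k / L) = pi * k" "- (pi * L) * (k / L) = - (pi * k)" using assms by auto
    moreover have "iexp (pi * k) = iexp (- (pi * k))"
      using exp_plus_2pin[of "\<i> * of_real (- (pi * k))" k] by (simp add: algebra_simps)
    ultimately show ?thesis unfolding F_def by simp
  qed
  finally show ?thesis using False by simp
qed

text \<open>The \<open>q\<close>-mass of the n-step paths that end at a. End points are integers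
  because later ones are thresholds minus arbitrary offsets, which may be negative.\<close>

definition walk_prob ::
  "'r set \<Rightarrow> nat set \<Rightarrow> ('r \<Rightarrow> nat \<Rightarrow> nat) \<Rightarrow> ('r \<Rightarrow> real) \<Rightarrow> nat \<Rightarrow> (nat \<Rightarrow> int) \<Rightarrow> real" where
  "walk_prob R I W q n a = (\<Sum>v\<in>PiE {..<n} (\<lambda>_. R).
     if \<forall>j\<in>I. int (\<Sum>i<n. W (v i) j) = a j then \<Prod>i<n. q (v i) else 0)"

text \<open>The product of the tilting factors along a path depends on the path only through its end
  point.\<close>

lemma walk_prob_tilt:
  assumes "finite I"
  shows "walk_prob R I W (\<lambda>r. q r * exp (\<Sum>j\<in>I. s j * (W r j - c j)) / Z) n a
    = walk_prob R I W q n a * exp (\<Sum>j\<in>I. s j * (a j - n * c j)) / Z ^ n"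
proof -
  have *: "(\<Prod>i<n. q (v i) * exp (\<Sum>j\<in>I. s j * (W (v i) j - c j)) / Z)
      = (\<Prod>i<n. q (v i)) * exp (\<Sum>j\<in>I. s j * (a j - n * c j)) / Z ^ n"
    if "\<forall>j\<in>I. int (\<Sum>i<n. W (v i) j) = a j" for v
  proof -
    have "(\<Sum>i<n. \<Sum>j\<in>I. s j * (W (v i) j - c j)) = (\<Sum>j\<in>I. s j * (\<Sum>i<n. W (v i) j - c j))"
      by (subst sum.swap) (simp add: sum_distrib_left)
    also have "\<dots> = (\<Sum>j\<in>I. s j * (a j - n * c j))"
    proof (intro sum.cong refl)
      fix j assume "j \<in> I"
      then have "real_of_int (a j) = (\<Sum>i<n. real (W (v i) j))"
        by (simp flip: of_nat_sum that[rule_format])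
      then show "s j * (\<Sum>i<n. W (v i) j - c j) = s j * (a j - n * c j)"
        by (simp add: sum_subtractf)
    qed
    finally show ?thesis by (simp add: prod_dividef prod.distrib flip: exp_sum)
  qed
  show ?thesis unfolding walk_prob_def sum_distrib_right sum_divide_distrib
    by (intro sum.cong refl) (simp add: *)
qed

lemma component_borel:
  "j \<in> I \<Longrightarrow> (\<lambda>s. s j) \<in> borel_measurable (PiM I (\<lambda>_. lborel :: real measure))"
  using measurable_component_singleton[of j I "\<lambda>_. lborel"] by simp

text \<open>\<open>\<epsilon>\<close> is a common lower bound of the step probabilities; the constants of the bounds below depend on it,
  but not on \<open>q\<close>, so that they stay uniform under exponential tilting.\<close>

locale lattice_walk =
  fixes R :: "'r set" and I :: "nat set" and W :: "'r \<Rightarrow> nat \<Rightarrow> nat" and q :: "'r \<Rightarrow> real" and \<epsilon> :: real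
  assumes finite_R: "finite R" and finite_I: "finite I"
    and eps_pos: "\<epsilon> > 0" and q_ge: "r \<in> R \<Longrightarrow> \<epsilon> \<le> q r" and q_sum: "(\<Sum>r\<in>R. q r) = 1"
    and W_le: "r \<in> R \<Longrightarrow> j \<in> I \<Longrightarrow> W r j \<le> 1"
    and zero_step: "\<exists>r\<in>R. \<forall>j\<in>I. W r j = 0"
    and unit_step: "i \<in> I \<Longrightarrow> \<exists>r\<in>R. \<forall>j\<in>I. W r j = (if j = i then 1 else 0)"
begin

definition mean :: "nat \<Rightarrow> real" where "mean j = (\<Sum>r\<in>R. q r * W r j)"

definition cov :: "nat \<Rightarrow> nat \<Rightarrow> real" where
  "cov i j = (\<Sum>r\<in>R. q r * (W r i - mean i) * (W r j - mean j))"

definition dev :: "(nat \<Rightarrow> real) \<Rightarrow> 'r \<Rightarrow> real" where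
  "dev t r = (\<Sum>j\<in>I. t j * (W r j - mean j))"

definition phi :: "(nat \<Rightarrow> real) \<Rightarrow> complex" where
  "phi t = (\<Sum>r\<in>R. of_real (q r) * iexp (dev t r))"

lemma q_pos: "r \<in> R \<Longrightarrow> q r > 0"
  using q_ge eps_pos by force

lemma mean_bounds: "j \<in> I \<Longrightarrow> 0 \<le> mean j \<and> mean j \<le> 1"
proof
  assume j: "j \<in> I"
  show "0 \<le> mean j" unfolding mean_def using q_pos by (intro sum_nonneg mult_nonneg_nonneg) (auto simp: less_imp_le)
  have "mean j \<le> (\<Sum>r\<in>R. q r * 1)" unfolding mean_def
    using q_pos W_le[OF _ j] by (intro sum_mono mult_left_mono) (auto simp: less_imp_le)
  then show "mean j \<le> 1" using q_sum by simp
qed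

lemma sum_dev: "(\<Sum>r\<in>R. q r * dev t r) = 0"
proof -
  have "(\<Sum>r\<in>R. q r * dev t r) = (\<Sum>j\<in>I. t j * (\<Sum>r\<in>R. q r * (W r j - mean j)))"
    unfolding dev_def sum_distrib_left by (subst sum.swap) (simp add: mult_ac)
  also have "(\<lambda>j. \<Sum>r\<in>R. q r * (W r j - mean j)) = (\<lambda>j. 0)"
    using q_sum by (simp add: right_diff_distrib sum_subtractf mean_def flip: sum_distrib_right)
  finally show ?thesis by simp
qed

lemma sum_dev_sq: "(\<Sum>r\<in>R. q r * (dev t r)\<^sup>2) = qform I cov t"
proof -
  have "(\<Sum>r\<in>R. q r * (dev t r)\<^sup>2)
      = (\<Sum>r\<in>R. \<Sum>i\<in>I. \<Sum>j\<in>I. t i * (q r * (W r i - mean i) * (W r j - mean j)) * t j)"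
    unfolding dev_def power2_eq_square sum_product by (simp add: sum_distrib_left mult_ac)
  also have "\<dots> = (\<Sum>i\<in>I. \<Sum>j\<in>I. \<Sum>r\<in>R. t i * (q r * (W r i - mean i) * (W r j - mean j)) * t j)"
    by (subst sum.swap, subst (2) sum.swap) simp
  also have "\<dots> = qform I cov t"
    by (simp add: qform_def cov_def sum_distrib_left sum_distrib_right)
  finally show ?thesis .
qed

text \<open>The zero step and the i-th unit step isolate \<open>t i\<close>. This one fact yields
  both the nondegeneracy of \<open>cov\<close> and the decay of \<open>phi\<close>.\<close>

lemma dev_differences:
  assumes "i \<in> I"
  obtains r0 r1 where "r0 \<in> R" "r1 \<in> R" "r0 \<noteq> r1" "\<And>t. dev t r1 = dev t r0 + t i"
proof -
  obtain r0 where r0: "r0 \<in> R" "\<And>j. j \<in> I \<Longrightarrow> W r0 j = 0" using zero_step by blast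
  obtain r1 where r1: "r1 \<in> R" "\<And>j. j \<in> I \<Longrightarrow> W r1 j = (if j = i then 1 else 0)"
    using unit_step[OF assms] by blast
  have "dev t r1 = dev t r0 + t i" for t
  proof -
    have "dev t r1 - dev t r0 = (\<Sum>j\<in>I. if j = i then t j else 0)"
      unfolding dev_def sum_subtractf[symmetric] using r0 r1 by (intro sum.cong) (auto simp: algebra_simps)
    then show ?thesis using assms finite_I by simp
  qed
  moreover have "r0 \<noteq> r1" using r0(2)[OF assms] r1(2)[OF assms] by auto
  ultimately show thesis using that r0(1) r1(1) by blast
qed

text \<open>As \<open>t i\<close> is the difference of two deviations, its square is at most twice
  the sum of their squares, and both outcomes have mass at least \<epsilon>: each coordinate gets
  the constant \<epsilon> / 2. Averaging over the coordinates divides by their number;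
  \<open>card I + 1\<close> also covers the empty index set.\<close>

lemma cov_coercive: "sym_coercive I (\<epsilon> / (2 * (card I + 1))) cov"
proof -
  have sq: "\<epsilon> / 2 * (t i)\<^sup>2 \<le> qform I cov t" if i: "i \<in> I" for t i
  proof -
    obtain r0 r1 where r: "r0 \<in> R" "r1 \<in> R" "r0 \<noteq> r1" "dev t r1 = dev t r0 + t i"
      using dev_differences[OF i] by metis
    have "(t i)\<^sup>2 \<le> 2 * (dev t r0)\<^sup>2 + 2 * (dev t r1)\<^sup>2"
      using zero_le_power2[of "dev t r0 + dev t r1"] r(4) by (simp add: power2_eq_square algebra_simps)
    then have "\<epsilon> / 2 * (t i)\<^sup>2 \<le> \<epsilon> / 2 * (2 * (dev t r0)\<^sup>2 + 2 * (dev t r1)\<^sup>2)"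
      using eps_pos by (intro mult_left_mono) auto
    also have "\<dots> = \<epsilon> * (dev t r0)\<^sup>2 + \<epsilon> * (dev t r1)\<^sup>2" by (simp add: algebra_simps)
    also have "\<dots> \<le> (\<Sum>r\<in>{r0, r1}. q r * (dev t r)\<^sup>2)"
      using r q_ge by (auto intro!: add_mono mult_right_mono)
    also have "\<dots> \<le> (\<Sum>r\<in>R. q r * (dev t r)\<^sup>2)"
      using r q_pos finite_R by (intro sum_mono2) (auto simp: less_imp_le)
    finally show ?thesis by (simp add: sum_dev_sq)
  qed
  have "\<epsilon> / (2 * (card I + 1)) * (\<Sum>i\<in>I. (t i)\<^sup>2) \<le> qform I cov t" for t
  proof -
    have "0 \<le> qform I cov t"
      unfolding sum_dev_sq[symmetric] using q_pos by (intro sum_nonneg) (auto simp: less_imp_le)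
    moreover have "(\<Sum>i\<in>I. \<epsilon> / 2 * (t i)\<^sup>2) \<le> (\<Sum>i\<in>I. qform I cov t)"
      by (intro sum_mono sq)
    ultimately have "\<epsilon> / 2 * (\<Sum>i\<in>I. (t i)\<^sup>2) \<le> qform I cov t * (card I + 1)"
      by (simp add: sum_distrib_left algebra_simps)
    then show ?thesis by (simp add: divide_simps algebra_simps)
  qed
  moreover have "cov i j = cov j i" for i j by (simp add: cov_def mult_ac)
  ultimately show ?thesis using eps_pos by (simp add: sym_coercive_def)
qed

lemma norm_phi_le_1: "norm (phi t) \<le> 1"
proof -
  have "norm (phi t) \<le> (\<Sum>r\<in>R. norm (of_real (q r) * iexp (dev t r)))"
    unfolding phi_def by (rule norm_sum)
  also have "\<dots> = (\<Sum>r\<in>R. q r)" using q_pos by (intro sum.cong) (auto simp: norm_mult less_imp_le)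
  finally show ?thesis using q_sum by simp
qed

text \<open>Split mass \<epsilon> off both outcomes of \<open>dev_differences\<close>. The rest
  contributes at most 1 - 2 \<epsilon>, and the cancellation within the pair gives a bound for each
  single coordinate. The geometric mean of these bounds and the trivial bound 1 involves all
  coordinates.\<close>

lemma norm_phi_le:
  assumes "\<And>i. i \<in> I \<Longrightarrow> \<bar>t i\<bar> \<le> pi"
  shows "norm (phi t) \<le> exp (- (\<epsilon> / (6 * (card I + 1))) * (\<Sum>i\<in>I. (t i)\<^sup>2))"
proof -

  have one: "norm (phi t) \<le> exp (- (\<epsilon> / 6) * (t i)\<^sup>2)" if i: "i \<in> I" for i
  proof -
    obtain r0 r1 where r: "r0 \<in> R" "r1 \<in> R" "r0 \<noteq> r1" "dev t r1 = dev t r0 + t i"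
      using dev_differences[OF i] by metis
    define w where "w r = q r - (if r \<in> {r0, r1} then \<epsilon> else 0)" for r
    have w: "w r \<ge> 0" if "r \<in> R" for r using that q_ge[OF that] q_pos[OF that] by (auto simp: w_def)
    have e: "(\<Sum>r\<in>R. if r \<in> {r0, r1} then f r else 0) = f r0 + f r1" for f :: "'r \<Rightarrow> 'x :: comm_monoid_add"
      using r finite_R by (subst sum.inter_restrict[symmetric]) (auto simp: Int_absorb1)
    have "phi t = (\<Sum>r\<in>R. of_real (w r) * iexp (dev t r)) + (\<Sum>r\<in>R. if r \<in> {r0, r1} then of_real \<epsilon> * iexp (dev t r) else 0)"
      unfolding phi_def w_def sum.distrib[symmetric] by (intro sum.cong) (auto simp: algebra_simps)
    also have "(\<Sum>r\<in>R. if r \<in> {r0, r1} then of_real \<epsilon> * iexp (dev t r) else 0)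
       = of_real \<epsilon> * iexp (dev t r0) + of_real \<epsilon> * iexp (dev t r1)" by (rule e)
    also have "\<dots> = of_real \<epsilon> * iexp (dev t r0) * (1 + iexp (t i))"
      unfolding r(4) of_real_add ring_distribs exp_add by simp
    finally have "norm (phi t) \<le> norm (\<Sum>r\<in>R. of_real (w r) * iexp (dev t r)) + norm (of_real \<epsilon> * iexp (dev t r0) * (1 + iexp (t i)))"
      by (simp only: norm_triangle_ineq)
    also have "norm (\<Sum>r\<in>R. of_real (w r) * iexp (dev t r)) \<le> (\<Sum>r\<in>R. norm (of_real (w r) * iexp (dev t r)))"
      by (rule norm_sum)
    also have "\<dots> = (\<Sum>r\<in>R. w r)" using w by (intro sum.cong) (auto simp: norm_mult)
    also have "\<dots> = 1 - 2 * \<epsilon>" unfolding w_def sum_subtractf q_sum e by simp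
    also have "norm (of_real \<epsilon> * iexp (dev t r0) * (1 + iexp (t i))) \<le> \<epsilon> * (2 - (t i)\<^sup>2 / 6)"
      using eps_pos norm_one_plus_iexp[OF assms[OF i]] by (simp add: norm_mult)
    also have "1 - 2 * \<epsilon> + \<epsilon> * (2 - (t i)\<^sup>2 / 6) = 1 + - (\<epsilon> / 6) * (t i)\<^sup>2" by (simp add: algebra_simps)
    also have "\<dots> \<le> exp (- (\<epsilon> / 6) * (t i)\<^sup>2)" by (rule exp_ge_add_one_self)
    finally show ?thesis by simp
  qed
  show ?thesis
  proof (cases "phi t = 0")
    case False
    define l where "l = ln (norm (phi t))"
    have ph: "norm (phi t) = exp l" using False by (simp add: l_def)
    have "(\<Sum>i\<in>I. l) \<le> (\<Sum>i\<in>I. - (\<epsilon> / 6) * (t i)\<^sup>2)"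
      by (intro sum_mono) (use one ph in simp)
    moreover have "l \<le> 0" using norm_phi_le_1[of t] ph by simp
    ultimately have "l * (card I + 1) \<le> - (\<epsilon> / 6) * (\<Sum>i\<in>I. (t i)\<^sup>2)"
      by (simp add: sum_distrib_left algebra_simps sum_negf)
    then have "l \<le> - (\<epsilon> / 6) * (\<Sum>i\<in>I. (t i)\<^sup>2) / (card I + 1)" by (simp add: divide_simps algebra_simps)
    then show ?thesis unfolding ph by simp
  qed simp
qed

end

section \<open>The local limit theorem\<close>

context lattice_walk
begin

text \<open>In the unit disc, n-th powers differ by at most n times the difference of their bases,
  so an error o(1/n) per factor suffices. The third absolute moment gives n^(-3/2), and
  \<open>z n\<close>, whose n-th power is the limit, differs from 1 - Q/(2n) by O(n^(-2)).\<close>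

lemma phi_power_limit:
  "(\<lambda>n. phi (\<lambda>j. s j / sqrt n) ^ n) \<longlonglongrightarrow> of_real (exp (- qform I cov s / 2))"
proof -
  define D where "D = (\<Sum>r\<in>R. q r * \<bar>dev s r\<bar> ^ 3)"
  define Q where "Q = qform I cov s"
  define z where "z n = complex_of_real (exp (- Q / (2 * n)))" for n :: nat
  have Q0: "Q \<ge> 0"
    unfolding Q_def sum_dev_sq[symmetric] using q_pos by (intro sum_nonneg) (auto simp: less_imp_le)
  have dev_scale: "dev (\<lambda>j. s j / c) r = dev s r / c" for c r
    by (simp add: dev_def sum_divide_distrib)

  have phi_approx: "norm (phi (\<lambda>j. s j / sqrt n) - (1 - of_real (Q / (2 * n)))) \<le> D / (6 * sqrt n ^ 3)"
    if n: "n > 0" for n :: nat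
  proof -
    have "(\<Sum>r\<in>R. of_real (q r) * (1 + \<i> * of_real (dev s r / sqrt n) - of_real ((dev s r / sqrt n)\<^sup>2 / 2)))
       = of_real (\<Sum>r\<in>R. q r) + \<i> * of_real ((\<Sum>r\<in>R. q r * dev s r) / sqrt n) - of_real ((\<Sum>r\<in>R. q r * (dev s r)\<^sup>2) / (2 * n))"
      using n by (simp add: algebra_simps sum.distrib sum_subtractf sum_distrib_left sum_divide_distrib power_divide)
    also have "\<dots> = 1 - of_real (Q / (2 * n))" by (simp add: q_sum sum_dev sum_dev_sq Q_def)
    finally have "norm (phi (\<lambda>j. s j / sqrt n) - (1 - of_real (Q / (2 * n))))
      = norm (\<Sum>r\<in>R. of_real (q r) * (iexp (dev s r / sqrt n) - (1 + \<i> * of_real (dev s r / sqrt n) - of_real ((dev s r / sqrt n)\<^sup>2 / 2))))"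
      unfolding phi_def dev_scale right_diff_distrib[of "of_real _"] sum_subtractf by simp
    also have "\<dots> \<le> (\<Sum>r\<in>R. q r * (\<bar>dev s r / sqrt n\<bar> ^ 3 / 6))"
    proof (rule order_trans[OF norm_sum], rule sum_mono)
      fix r assume r: "r \<in> R"
      let ?u = "dev s r / sqrt n"
      have "(\<Sum>k\<le>2. (\<i> * of_real u) ^ k / fact k) = 1 + \<i> * of_real u - of_real (u\<^sup>2 / 2)" for u
        by (simp add: numeral_2_eq_2 power2_eq_square algebra_simps)
      from this[of ?u] have "norm (iexp ?u - (1 + \<i> * of_real ?u - of_real (?u\<^sup>2 / 2))) \<le> \<bar>?u\<bar> ^ 3 / 6"
        using iexp_approx1[of ?u 2] by (simp add: fact_numeral)
      then show "norm (of_real (q r) * (iexp ?u - (1 + \<i> * of_real ?u - of_real (?u\<^sup>2 / 2)))) \<le> q r * (\<bar>?u\<bar> ^ 3 / 6)"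
        using q_pos[OF r] by (simp add: norm_mult)
    qed
    also have "\<dots> = D / (6 * sqrt n ^ 3)"
      by (simp add: D_def sum_divide_distrib power_divide mult_ac)
    finally show ?thesis .
  qed
  have z_approx: "norm ((1 - of_real (Q / (2 * n))) - z n) \<le> (Q / (2 * n))\<^sup>2 / 2" for n :: nat
  proof -
    let ?u = "Q / (2 * n)"
    have eq: "(1 - of_real ?u) - z n = of_real (1 - ?u - exp (- ?u))" by (simp add: z_def)
    have l: "1 - ?u \<le> exp (- ?u)" using exp_ge_add_one_self[of "- ?u"] by simp
    have u: "exp (- ?u) \<le> 1 - ?u + ?u\<^sup>2 / 2"
    proof -
      \<comment> \<open>exp u is at least 1 + u + u^2/2, and (1 + u + u^2/2) (1 - u + u^2/2) = 1 +
        u^4/4 is at least 1.\<close>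
      have *: "exp (- u) \<le> 1 - u + u\<^sup>2 / 2" if "u \<ge> 0" for u :: real
      proof -
        have "1 = exp u * exp (- u)" by (simp flip: exp_add)
        also have "(1 + u + u\<^sup>2 / 2) * exp (- u) \<le> exp u * exp (- u)"
          using exp_lower_Taylor_quadratic[OF that] by (intro mult_right_mono) auto
        finally have "(1 + u + u\<^sup>2 / 2) * exp (- u) \<le> 1" by (simp flip: exp_add)
        also have "1 \<le> 1 + (u\<^sup>2)\<^sup>2 / 4" by simp
        also have "\<dots> = (1 + u + u\<^sup>2 / 2) * (1 - u + u\<^sup>2 / 2)"
          by (simp add: power2_eq_square field_simps)
        finally show ?thesis
          by (rule mult_left_le_imp_le) (use that in \<open>simp add: add_pos_nonneg\<close>)
      qed
      show ?thesis using *[of ?u] Q0 by simp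
    qed
    show ?thesis unfolding eq norm_of_real abs_le_iff using l u zero_le_power2[of ?u] by linarith
  qed
  have "(\<lambda>n. phi (\<lambda>j. s j / sqrt n) ^ n - z n ^ n) \<longlonglongrightarrow> 0"
  proof (rule Lim_null_comparison)
    have "(\<lambda>n::nat. 1 / sqrt n) \<longlonglongrightarrow> 0" "(\<lambda>n::nat. 1 / real n) \<longlonglongrightarrow> 0" by real_asymp+
    then have "(\<lambda>n::nat. D / 6 * (1 / sqrt n) + Q\<^sup>2 / 8 * (1 / real n)) \<longlonglongrightarrow> D / 6 * 0 + Q\<^sup>2 / 8 * 0"
      by (intro tendsto_add tendsto_mult tendsto_const)
    then show "(\<lambda>n::nat. D / 6 * (1 / sqrt n) + Q\<^sup>2 / 8 * (1 / real n)) \<longlonglongrightarrow> 0" by simp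
    show "\<forall>\<^sub>F n in sequentially. norm (phi (\<lambda>j. s j / sqrt n) ^ n - z n ^ n)
       \<le> D / 6 * (1 / sqrt n) + Q\<^sup>2 / 8 * (1 / real n)"
      using eventually_gt_at_top[of 0]
    proof eventually_elim
      case (elim n)
      have "norm (z n) \<le> 1" using Q0 by (simp add: z_def)
      then have "norm (phi (\<lambda>j. s j / sqrt n) ^ n - z n ^ n) \<le> n * norm (phi (\<lambda>j. s j / sqrt n) - z n)"
        by (intro norm_power_diff norm_phi_le_1)
      also have "norm (phi (\<lambda>j. s j / sqrt n) - z n) \<le> D / (6 * sqrt n ^ 3) + (Q / (2 * n))\<^sup>2 / 2"
        using norm_triangle_le[OF add_mono[OF phi_approx[OF elim] z_approx[of n]]]
        by (simp only: diff_add_eq diff_diff_eq2 add_diff_cancel_right' diff_add_cancel add_diff_cancel add_diff_eq)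
      also have "n * (D / (6 * sqrt n ^ 3) + (Q / (2 * n))\<^sup>2 / 2) = D / 6 * (1 / sqrt n) + Q\<^sup>2 / 8 * (1 / real n)"
      proof -
        have "sqrt n ^ 3 = n * sqrt n" by (simp add: power3_eq_cube)
        then show ?thesis using elim by (simp add: distrib_left power2_eq_square)
      qed
      finally show ?case by (simp add: mult_left_mono)
    qed
  qed
  moreover have "z n ^ n = of_real (exp (- Q / 2))" if "n > 0" for n
    unfolding z_def of_real_power[symmetric] exp_of_nat_mult[symmetric] using that by simp
  then have "(\<lambda>n. z n ^ n) \<longlonglongrightarrow> of_real (exp (- Q / 2))"
    by (intro tendsto_eventually eventually_mono[OF eventually_gt_at_top[of 0]]) auto
  ultimately have "(\<lambda>n. (phi (\<lambda>j. s j / sqrt n) ^ n - z n ^ n) + z n ^ n) \<longlonglongrightarrow> 0 + of_real (exp (- Q / 2))"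
    by (rule tendsto_add)
  then show ?thesis by (simp add: Q_def)
qed

text \<open>Rescaled by sqrt n and cut off to a cube, so that all n share one domain of integration
  and dominated convergence applies.\<close>

definition fourier_integrand :: "nat \<Rightarrow> (nat \<Rightarrow> int) \<Rightarrow> (nat \<Rightarrow> real) \<Rightarrow> complex" where
  "fourier_integrand n a s = of_real (\<Prod>j\<in>I. indicator {- (pi * sqrt n)..pi * sqrt n} (s j)) *
     (phi (\<lambda>j. s j / sqrt n) ^ n * iexp (\<Sum>j\<in>I. - ((a j - n * mean j) / sqrt n) * s j))"

text \<open>Fourier inversion: the n-th power of \<open>phi\<close> expands into a sum over paths,
  the centrings cancel, and for each path orthogonality in every coordinate tests whether it ends at
  a.\<close>

lemma walk_prob_fourier:
  assumes "n > 0"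
  shows "(\<integral>s. fourier_integrand n a s \<partial>PiM I (\<lambda>_. lborel)) = of_real ((2 * pi * sqrt n) ^ card I * walk_prob R I W q n a)"
proof -
  let ?V = "PiE {..<n} (\<lambda>_. R)"
  let ?N = "\<lambda>v j. int (\<Sum>i<n. W (v i) j)"
  let ?ind = "\<lambda>x. indicator {- (pi * sqrt n)..pi * sqrt n} x :: real"
  let ?g = "\<lambda>v j x. ?ind x *\<^sub>R iexp (x * ((?N v j - a j) / sqrt n))"
  have phi_pow: "phi t ^ n = (\<Sum>v\<in>?V. of_real (\<Prod>i<n. q (v i)) * iexp (\<Sum>j\<in>I. t j * (?N v j - n * mean j)))" for t
  proof -
    have "phi t ^ n = (\<Prod>i<n. \<Sum>r\<in>R. of_real (q r) * iexp (dev t r))" by (simp add: phi_def)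
    also have "\<dots> = (\<Sum>v\<in>?V. \<Prod>i<n. of_real (q (v i)) * iexp (dev t (v i)))"
      by (rule prod_sum_PiE) (auto simp: finite_R)
    also have "\<dots> = (\<Sum>v\<in>?V. of_real (\<Prod>i<n. q (v i)) * iexp (\<Sum>j\<in>I. t j * (?N v j - n * mean j)))"
    proof (intro sum.cong refl)
      fix v
      have "(\<Sum>i<n. dev t (v i)) = (\<Sum>j\<in>I. t j * (?N v j - n * mean j))"
        unfolding dev_def by (subst sum.swap) (simp add: sum_subtractf flip: sum_distrib_left)
      then have "(\<Prod>i<n. iexp (dev t (v i))) = iexp (\<Sum>j\<in>I. t j * (?N v j - n * mean j))"
        by (simp only: exp_sum[OF finite_lessThan, symmetric] sum_distrib_left[symmetric] of_real_sum[symmetric])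
      then show "(\<Prod>i<n. of_real (q (v i)) * iexp (dev t (v i)))
         = of_real (\<Prod>i<n. q (v i)) * iexp (\<Sum>j\<in>I. t j * (?N v j - n * mean j))"
        by (simp add: prod.distrib)
    qed
    finally show ?thesis .
  qed
  have integrand: "fourier_integrand n a s = (\<Sum>v\<in>?V. of_real (\<Prod>i<n. q (v i)) * (\<Prod>j\<in>I. ?g v j (s j)))" for s
  proof -
    have e: "iexp (\<Sum>j\<in>I. s j / sqrt n * (?N v j - n * mean j)) * iexp (\<Sum>j\<in>I. - ((a j - n * mean j) / sqrt n) * s j)
        = (\<Prod>j\<in>I. iexp (s j * ((?N v j - a j) / sqrt n)))" for v
    proof -
      have "(\<Sum>j\<in>I. s j / sqrt n * (?N v j - n * mean j)) + (\<Sum>j\<in>I. - ((a j - n * mean j) / sqrt n) * s j)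
          = (\<Sum>j\<in>I. s j * ((?N v j - a j) / sqrt n))"
        unfolding sum.distrib[symmetric] by (intro sum.cong) (auto simp: divide_inverse algebra_simps)
      then show ?thesis using finite_I
        unfolding exp_add[symmetric] ring_distribs(1)[symmetric] of_real_add[symmetric]
        by (simp only: of_real_sum sum_distrib_left exp_sum)
    qed
    have factor: "c * ((\<Sum>v\<in>V. f v * g v) * e) = (\<Sum>v\<in>V. f v * (c * (g v * e)))"
      for c e :: complex and f g and V :: "(nat \<Rightarrow> 'r) set"
      by (simp add: sum_distrib_left sum_distrib_right mult_ac)
    have "fourier_integrand n a s = (\<Sum>v\<in>?V. of_real (\<Prod>i<n. q (v i)) * (of_real (\<Prod>j\<in>I. ?ind (s j)) *
        (iexp (\<Sum>j\<in>I. s j / sqrt n * (?N v j - n * mean j)) * iexp (\<Sum>j\<in>I. - ((a j - n * mean j) / sqrt n) * s j))))"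
      unfolding fourier_integrand_def phi_pow by (rule factor)
    then show ?thesis unfolding e by (simp add: scaleR_conv_of_real prod.distrib)
  qed
  have g_int: "integrable lborel (?g v j)" for v j
    by (rule borel_integrable_compact) (use assms in \<open>auto intro!: continuous_intros\<close>)
  have "(\<integral>s. fourier_integrand n a s \<partial>PiM I (\<lambda>_. lborel))
     = (\<Sum>v\<in>?V. of_real (\<Prod>i<n. q (v i)) * (\<Prod>j\<in>I. integral\<^sup>L lborel (?g v j)))"
    unfolding integrand
    by (subst Bochner_Integration.integral_sum)
       (simp_all only: integral_mult_right_zero lborel_product.product_integral_prod[OF finite_I g_int]
          integrable_mult_right lborel_product.product_integrable_prod[OF finite_I g_int])
  also have "\<dots> = (\<Sum>v\<in>?V. of_real (\<Prod>i<n. q (v i)) * (if \<forall>j\<in>I. ?N v j = a j then of_real ((2 * pi * sqrt n) ^ card I) else 0))"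
  proof (intro sum.cong refl arg_cong2[where f = "(*)"])
    fix v
    have "integral\<^sup>L lborel (?g v j) = (if ?N v j = a j then of_real (2 * pi * sqrt n) else 0)" for j
      using integral_iexp_period[of "sqrt n" "?N v j - a j"] assms by simp
    then show "(\<Prod>j\<in>I. integral\<^sup>L lborel (?g v j)) = (if \<forall>j\<in>I. ?N v j = a j then of_real ((2 * pi * sqrt n) ^ card I) else 0)"
      using finite_I by (auto intro: prod_zero)
  qed
  also have "\<dots> = of_real ((2 * pi * sqrt n) ^ card I * walk_prob R I W q n a)"
    unfolding walk_prob_def sum_distrib_left of_real_sum by (intro sum.cong) auto
  finally show ?thesis .
qed

lemma fourier_integrand_measurable [measurable]:
  "fourier_integrand n a \<in> borel_measurable (PiM I (\<lambda>_. lborel))"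
proof -
  let ?M = "PiM I (\<lambda>_. lborel) :: (nat \<Rightarrow> real) measure"
  have dev: "(\<lambda>s. dev (\<lambda>j. s j / sqrt n) r) \<in> borel_measurable ?M" for r
    unfolding dev_def
    by (intro borel_measurable_sum borel_measurable_times borel_measurable_divide borel_measurable_const component_borel)
  have iexp: "(\<lambda>s. iexp (h s)) \<in> borel_measurable ?M" if [measurable]: "h \<in> borel_measurable ?M" for h
    by measurable
  have of_real: "(\<lambda>s. complex_of_real (h s)) \<in> borel_measurable ?M" if [measurable]: "h \<in> borel_measurable ?M" for h
    by measurable
  have phi: "(\<lambda>s. phi (\<lambda>j. s j / sqrt n)) \<in> borel_measurable ?M"
    unfolding phi_def by (intro borel_measurable_sum borel_measurable_times borel_measurable_const iexp dev)
  have ind: "(\<lambda>s. \<Prod>j\<in>I. indicator {- (pi * sqrt n)..pi * sqrt n} (s j) :: real) \<in> borel_measurable ?M"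
    by (intro borel_measurable_prod borel_measurable_indicator' component_borel) auto
  have "(\<lambda>s. \<Sum>j\<in>I. - ((a j - n * mean j) / sqrt n) * s j) \<in> borel_measurable ?M"
    by (intro borel_measurable_sum borel_measurable_times borel_measurable_const component_borel)
  then show ?thesis
    unfolding fourier_integrand_def
    by (intro borel_measurable_times borel_measurable_power of_real iexp phi ind)
qed

text \<open>Taking the n-th power of the bound at s / sqrt n cancels n, so the majorant is
  independent of n. The cutoff keeps the argument in the cube required by
  \<open>norm_phi_le\<close>.\<close>

lemma norm_fourier_integrand_le:
  assumes "n > 0"
  shows "norm (fourier_integrand n a s) \<le> exp (- (\<epsilon> / (6 * (card I + 1))) * (\<Sum>i\<in>I. (s i)\<^sup>2))"
proof (cases "\<forall>j\<in>I. s j \<in> {- (pi * sqrt n)..pi * sqrt n}")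
  case True
  let ?\<kappa> = "\<epsilon> / (6 * (card I + 1))"
  have "\<bar>s i / sqrt n\<bar> \<le> pi" if "i \<in> I" for i
  proof -
    have "\<bar>s i\<bar> \<le> pi * sqrt n" using True that by (auto simp: abs_le_iff)
    then show ?thesis using assms by (simp add: pos_divide_le_eq)
  qed
  then have "norm (phi (\<lambda>j. s j / sqrt n)) \<le> exp (- ?\<kappa> * (\<Sum>i\<in>I. (s i / sqrt n)\<^sup>2))"
    by (rule norm_phi_le)
  then have "norm (phi (\<lambda>j. s j / sqrt n)) ^ n \<le> exp (- ?\<kappa> * (\<Sum>i\<in>I. (s i / sqrt n)\<^sup>2)) ^ n"
    by (rule power_mono) simp
  also have "\<dots> = exp (- ?\<kappa> * (\<Sum>i\<in>I. (s i)\<^sup>2))"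
  proof -
    have "(\<Sum>i\<in>I. (s i / sqrt n)\<^sup>2) = (\<Sum>i\<in>I. (s i)\<^sup>2) / n"
      by (simp add: power_divide sum_divide_distrib)
    then show ?thesis unfolding exp_of_nat_mult[symmetric] using assms by simp
  qed
  finally have le: "norm (phi (\<lambda>j. s j / sqrt n)) ^ n \<le> exp (- ?\<kappa> * (\<Sum>i\<in>I. (s i)\<^sup>2))" .
  have one: "(\<Prod>j\<in>I. indicator {- (pi * sqrt n)..pi * sqrt n} (s j)) = (1 :: real)"
    using True by (intro prod.neutral) (auto simp: indicator_def)
  show ?thesis
    unfolding fourier_integrand_def one norm_mult norm_power norm_exp_i_times using le by simp
next
  case False
  then have "(\<Prod>j\<in>I. indicator {- (pi * sqrt n)..pi * sqrt n} (s j) :: real) = 0"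
    using finite_I by (intro prod_zero) (auto simp: indicator_def)
  then show ?thesis by (simp add: fourier_integrand_def)
qed

lemma local_limit:
  assumes x: "\<And>j. j \<in> I \<Longrightarrow> (\<lambda>n. (a n j - n * mean j) / sqrt n) \<longlonglongrightarrow> x j"
    and y: "\<And>i. i \<in> I \<Longrightarrow> (\<Sum>j\<in>I. cov i j * y j) = x i"
  shows "(\<lambda>n. sqrt n ^ card I * walk_prob R I W q n (a n)) \<longlonglongrightarrow>
    exp (- (\<Sum>i\<in>I. x i * y i) / 2) / sqrt ((2 * pi) ^ card I * det_on I cov)"
proof -
  let ?M = "PiM I (\<lambda>_. lborel) :: (nat \<Rightarrow> real) measure"
  let ?f = "\<lambda>s. of_real (exp (- qform I cov s / 2)) * iexp (\<Sum>i\<in>I. - x i * s i)"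
  let ?L = "sqrt ((2 * pi) ^ card I / det_on I cov) * exp (- (\<Sum>i\<in>I. x i * y i) / 2)"
  \<comment> \<open>The sequence starts at index 1 because the inversion formula and the majorant
    are available for positive n.\<close>
  have "(\<lambda>n. integral\<^sup>L ?M (fourier_integrand (Suc n) (a (Suc n)))) \<longlonglongrightarrow> integral\<^sup>L ?M ?f"
  proof (rule integral_dominated_convergence)
    show "?f \<in> borel_measurable ?M" unfolding qform_def by measurable
    show "integrable ?M (\<lambda>s. exp (- (\<epsilon> / (6 * (card I + 1))) * (\<Sum>i\<in>I. (s i)\<^sup>2)))"
      using eps_pos finite_I by (intro integrable_gaussian_PiM) auto
    show "AE s in ?M. norm (fourier_integrand (Suc n) (a (Suc n)) s)
        \<le> exp (- (\<epsilon> / (6 * (card I + 1))) * (\<Sum>i\<in>I. (s i)\<^sup>2))" for n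
      by (intro AE_I2 norm_fourier_integrand_le) simp
    show "AE s in ?M. (\<lambda>n. fourier_integrand (Suc n) (a (Suc n)) s) \<longlonglongrightarrow> ?f s"
    proof (rule AE_I2, rule LIMSEQ_Suc)
      fix s
      have ind: "\<forall>\<^sub>F n in sequentially. (\<Prod>j\<in>I. indicator {- (pi * sqrt n)..pi * sqrt n} (s j)) = (1 :: real)"
      proof -
        have "\<forall>\<^sub>F n in sequentially. \<bar>s j\<bar> \<le> pi * sqrt (real n)" for j by real_asymp
        then have "\<forall>\<^sub>F n in sequentially. \<forall>j\<in>I. \<bar>s j\<bar> \<le> pi * sqrt (real n)"
          using finite_I by (simp add: eventually_ball_finite_distrib)
        then show ?thesis by eventually_elim (auto intro!: prod.neutral simp: abs_le_iff)
      qed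
      have "(\<lambda>n. iexp (\<Sum>j\<in>I. - ((a n j - n * mean j) / sqrt n) * s j)) \<longlonglongrightarrow> iexp (\<Sum>i\<in>I. - x i * s i)"
        by (intro tendsto_intros x)
      then have "(\<lambda>n. of_real 1 * (phi (\<lambda>j. s j / sqrt n) ^ n * iexp (\<Sum>j\<in>I. - ((a n j - n * mean j) / sqrt n) * s j))) \<longlonglongrightarrow> of_real 1 * ?f s"
        by (intro tendsto_mult phi_power_limit tendsto_const)
      then show "(\<lambda>n. fourier_integrand n (a n) s) \<longlonglongrightarrow> ?f s"
        unfolding fourier_integrand_def mult_1 of_real_1
        by (rule Lim_transform_eventually) (use ind in eventually_elim, simp)
    qed
  qed measurable
  moreover have "integral\<^sup>L ?M (fourier_integrand (Suc n) (a (Suc n)))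
     = of_real ((2 * pi * sqrt (Suc n)) ^ card I * walk_prob R I W q (Suc n) (a (Suc n)))" for n
    by (rule walk_prob_fourier) simp
  moreover have "integral\<^sup>L ?M ?f = of_real ?L"
  proof -
    \<comment> \<open>The frequency in \<open>?f\<close> is the negative of x; the solution becomes
      the negative of y and the exponent does not change.\<close>
    have "(\<Sum>j\<in>I. cov i j * - y j) = - x i" if "i \<in> I" for i
      using y[OF that] by (simp add: sum_negf)
    from gaussian_char_PiM[OF finite_I cov_coercive this] show ?thesis by simp
  qed
  ultimately have "(\<lambda>n. complex_of_real ((2 * pi * sqrt (Suc n)) ^ card I * walk_prob R I W q (Suc n) (a (Suc n)))) \<longlonglongrightarrow> of_real ?L"
    by simp
  then have "(\<lambda>n. (2 * pi * sqrt (Suc n)) ^ card I * walk_prob R I W q (Suc n) (a (Suc n))) \<longlonglongrightarrow> ?L"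
    by (subst (asm) tendsto_of_real_iff)
  then have "(\<lambda>n. (2 * pi * sqrt n) ^ card I * walk_prob R I W q n (a n)) \<longlonglongrightarrow> ?L"
    by (rule LIMSEQ_imp_Suc)
  then have "(\<lambda>n. (2 * pi * sqrt n) ^ card I * walk_prob R I W q n (a n) / (2 * pi) ^ card I) \<longlonglongrightarrow> ?L / (2 * pi) ^ card I"
    by (intro tendsto_divide tendsto_const) auto
  moreover have "?L / (2 * pi) ^ card I = exp (- (\<Sum>i\<in>I. x i * y i) / 2) / sqrt ((2 * pi) ^ card I * det_on I cov)"
  proof -
    have "sqrt (b / d) * e / b = e / sqrt (b * d)" if "b > 0" for b d e :: real
    proof -
      have "sqrt (b / d) * e / b = e * (sqrt b / (sqrt b * sqrt b)) / sqrt d"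
        using that by (simp add: real_sqrt_divide mult_ac)
      then show ?thesis using that by (simp add: real_sqrt_mult del: real_sqrt_mult_self)
    qed
    from this[of "(2 * pi) ^ card I" "det_on I cov"] show ?thesis by simp
  qed
  ultimately show ?thesis by (simp add: power_mult_distrib)
qed

end

section \<open>Uniform exponential bounds\<close>

text \<open>Integral of the common Gaussian majorant of the Fourier integrands. It involves only I
  and \<epsilon>, so one value serves every tilted walk with the same \<epsilon>.\<close>

definition walk_bound :: "nat set \<Rightarrow> real \<Rightarrow> real" where
  "walk_bound I \<epsilon> = (\<integral>s. exp (- (\<epsilon> / (6 * (card I + 1))) * (\<Sum>i\<in>I. (s i)\<^sup>2)) \<partial>PiM I (\<lambda>_. lborel)) / (2 * pi) ^ card I"

lemma walk_bound_nonneg: "walk_bound I \<epsilon> \<ge> 0"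
  by (simp add: walk_bound_def)

lemma (in lattice_walk) walk_prob_le:
  assumes "n > 0"
  shows "sqrt n ^ card I * walk_prob R I W q n a \<le> walk_bound I \<epsilon>"
proof -
  let ?M = "PiM I (\<lambda>_. lborel) :: (nat \<Rightarrow> real) measure"
  let ?w = "\<lambda>s. exp (- (\<epsilon> / (6 * (card I + 1))) * (\<Sum>i\<in>I. (s i)\<^sup>2))"
  have "integrable ?M ?w" using eps_pos finite_I by (intro integrable_gaussian_PiM) auto
  then have "norm (integral\<^sup>L ?M (fourier_integrand n a)) \<le> integral\<^sup>L ?M ?w"
    using norm_fourier_integrand_le[OF assms]
    by (intro order_trans[OF integral_norm_bound] integral_mono') auto
  then have "(2 * pi * sqrt n) ^ card I * walk_prob R I W q n a \<le> integral\<^sup>L ?M ?w"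
    unfolding walk_prob_fourier[OF assms] norm_of_real by linarith
  then show ?thesis unfolding walk_bound_def
    by (simp add: pos_le_divide_eq power_mult_distrib mult_ac)
qed

lemma exp_le_quadratic:
  fixes x d :: real
  assumes "\<bar>x\<bar> \<le> d"
  shows "exp x \<le> 1 + x + x\<^sup>2 * exp d"
proof -
  obtain t where t: "\<bar>t\<bar> \<le> \<bar>x\<bar>" "exp x = (\<Sum>m<2. x ^ m / fact m) + exp t / fact 2 * x ^ 2"
    using Maclaurin_exp_le[of x 2] by blast
  have "exp t / 2 * x\<^sup>2 \<le> exp d * x\<^sup>2"
  proof (rule mult_right_mono)
    have "exp t \<le> exp d" using t(1) assms by simp
    moreover have "0 < exp t" by simp
    ultimately show "exp t / 2 \<le> exp d" by linarith
  qed simp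
  then show ?thesis using t(2) by (simp add: numeral_2_eq_2 mult.commute)
qed

context lattice_walk
begin

text \<open>Tilting the walk by \<open>\<plusminus>1 / sqrt n\<close> in every coordinate costs only a constant factor and turns the uniform
  bound into one with exponentially decaying tails on the scale \<open>sqrt n\<close>.\<close>

lemma walk_prob_exp_le:
  obtains K where "K \<ge> 0"
    "\<And>n a. n > 0 \<Longrightarrow> sqrt n ^ card I * walk_prob R I W q n a \<le> K * (\<Prod>j\<in>I. exp (- \<bar>a j - n * mean j\<bar> / sqrt n))"
proof
  define d where "d = real (card I)"
  \<comment> \<open>The first factor bounds \<open>Z ^ n\<close>. Tilting multiplies a mass by at
    least exp (-d), and dividing by Z costs at most another exp d, hence the new lower bound
    \<open>\<epsilon> * exp (- 2 * d)\<close>.\<close>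
  let ?K = "exp (d\<^sup>2 * exp d) * walk_bound I (\<epsilon> * exp (- 2 * d))"
  show "?K \<ge> 0" by (simp add: walk_bound_nonneg)
  fix n :: nat and a :: "nat \<Rightarrow> int"
  assume n: "n > 0"
  \<comment> \<open>With these signs the tilting exponent at a is the sum of the absolute deviations
    divided by sqrt n.\<close>
  define s where "s j = sgn (a j - n * mean j) / sqrt n" for j
  define Z where "Z = (\<Sum>r\<in>R. q r * exp (dev s r))"
  define q' where "q' r = q r * exp (\<Sum>j\<in>I. s j * (W r j - mean j)) / Z" for r
  have dev_n: "\<bar>dev s r\<bar> \<le> d / sqrt n" if r: "r \<in> R" for r
  proof -
    have "\<bar>s j * (W r j - mean j)\<bar> \<le> 1 / sqrt n" if j: "j \<in> I" for j
    proof -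
      have "\<bar>W r j - mean j\<bar> \<le> 1" using W_le[OF r j] mean_bounds[OF j] by (auto simp: abs_le_iff)
      moreover have "\<bar>s j\<bar> \<le> 1 / sqrt n" by (simp add: s_def sgn_real_def)
      ultimately have "\<bar>s j\<bar> * \<bar>W r j - mean j\<bar> \<le> 1 / sqrt n * 1" by (intro mult_mono) auto
      then show ?thesis by (simp add: abs_mult)
    qed
    then have "(\<Sum>j\<in>I. \<bar>s j * (W r j - mean j)\<bar>) \<le> (\<Sum>j\<in>I. 1 / sqrt n)" by (rule sum_mono)
    then show ?thesis unfolding dev_def d_def by (intro order_trans[OF sum_abs]) simp
  qed
  have dev_d: "\<bar>dev s r\<bar> \<le> d" if "r \<in> R" for r
  proof -
    have "d / sqrt n \<le> d / 1" using n by (intro divide_left_mono) (auto simp: d_def)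
    then show ?thesis using dev_n[OF that] by linarith
  qed
  have Z_ge: "Z \<ge> exp (- d)"
  proof -
    have "(\<Sum>r\<in>R. q r * exp (- d)) \<le> Z" unfolding Z_def
      using q_pos dev_d by (intro sum_mono mult_left_mono) (auto simp: less_imp_le abs_le_iff minus_le_iff)
    then show ?thesis using q_sum by (simp flip: sum_distrib_right)
  qed
  then have Z_pos: "Z > 0" by (meson exp_gt_zero less_le_trans)
  have Z_le: "Z \<le> exp d"
  proof -
    have "Z \<le> (\<Sum>r\<in>R. q r * exp d)" unfolding Z_def
      using q_pos dev_d by (intro sum_mono mult_left_mono) (auto simp: less_imp_le abs_le_iff)
    then show ?thesis using q_sum by (simp flip: sum_distrib_right)
  qed
  \<comment> \<open>The first-order term has mean 0, so Z is at most 1 + O(1/n) and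
    \<open>Z ^ n\<close> stays bounded. This is what permits a tilt of size 1 / sqrt n.\<close>
  have "Z \<le> (\<Sum>r\<in>R. q r * (1 + dev s r + d\<^sup>2 / n * exp d))" unfolding Z_def
  proof (intro sum_mono mult_left_mono)
    fix r assume r: "r \<in> R"
    have "(dev s r)\<^sup>2 \<le> d\<^sup>2 / n"
      using power_mono[OF dev_n[OF r], of 2] by (simp add: power_divide)
    then have "(dev s r)\<^sup>2 * exp d \<le> d\<^sup>2 / n * exp d" by (rule mult_right_mono) simp
    then show "exp (dev s r) \<le> 1 + dev s r + d\<^sup>2 / n * exp d"
      using exp_le_quadratic[OF dev_d[OF r]] by linarith
  qed (use q_pos in \<open>auto simp: less_imp_le\<close>)
  also have "\<dots> = 1 + d\<^sup>2 * exp d / n"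
    using q_sum sum_dev[of s] by (simp add: ring_distribs sum.distrib flip: sum_distrib_right sum_divide_distrib)
  also have "\<dots> \<le> exp (d\<^sup>2 * exp d / n)" by (rule exp_ge_add_one_self)
  finally have "Z ^ n \<le> exp (d\<^sup>2 * exp d / n) ^ n" using Z_pos by (intro power_mono) auto
  then have Z_pow: "Z ^ n \<le> exp (d\<^sup>2 * exp d)" using n by (simp flip: exp_of_nat_mult)
  \<comment> \<open>The tilted walk has a different mean, but the bound of
    \<open>walk_prob_le\<close> involves only I and \<epsilon>.\<close>
  interpret T: lattice_walk R I W q' "\<epsilon> * exp (- 2 * d)"
  proof
    show "\<epsilon> * exp (- 2 * d) \<le> q' r" if r: "r \<in> R" for r
    proof -
      have "\<epsilon> * exp (- d) / exp d \<le> q r * exp (dev s r) / Z"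
        using Z_pos Z_le q_ge[OF r] q_pos[OF r] eps_pos dev_d[OF r]
        by (intro frac_le mult_mono) (auto simp: less_imp_le abs_le_iff)
      moreover have "exp (- 2 * d) = exp (- d) / exp d" by (simp flip: exp_diff)
      ultimately show ?thesis by (simp add: q'_def dev_def)
    qed
    show "(\<Sum>r\<in>R. q' r) = 1"
      using Z_pos by (simp add: q'_def Z_def dev_def flip: sum_divide_distrib)
  qed (use finite_R finite_I eps_pos W_le zero_step unit_step in auto)
  let ?E = "\<Sum>j\<in>I. \<bar>a j - n * mean j\<bar> / sqrt n"
  have "(\<Sum>j\<in>I. s j * (a j - n * mean j)) = ?E"
    by (intro sum.cong) (auto simp: s_def sgn_real_def)
  then have tilt: "walk_prob R I W q' n a = walk_prob R I W q n a * exp ?E / Z ^ n"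
    unfolding q'_def by (subst walk_prob_tilt[OF finite_I]) simp
  have "sqrt n ^ card I * walk_prob R I W q n a = sqrt n ^ card I * walk_prob R I W q' n a * Z ^ n * exp (- ?E)"
    unfolding tilt using Z_pos by (simp add: exp_minus field_simps)
  also have "\<dots> \<le> walk_bound I (\<epsilon> * exp (- 2 * d)) * exp (d\<^sup>2 * exp d) * exp (- ?E)"
    using Z_pow Z_pos T.walk_prob_le[OF n] walk_bound_nonneg
    by (intro mult_right_mono mult_mono) auto
  also have "exp (- ?E) = (\<Prod>j\<in>I. exp (- \<bar>a j - n * mean j\<bar> / sqrt n))"
    using finite_I by (simp add: exp_sum flip: sum_negf)
  finally show "sqrt n ^ card I * walk_prob R I W q n a \<le> ?K * (\<Prod>j\<in>I. exp (- \<bar>a j - n * mean j\<bar> / sqrt n))"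
    by (simp add: mult_ac)
qed

end

section \<open>Integrals over lattice cells\<close>

lemma floor_cell_integral:
  fixes c :: real and l :: int
  assumes "c > 0"
  shows "has_bochner_integral lborel (\<lambda>x. indicator {0<..} x * of_bool (\<lfloor>c * x\<rfloor> = l) :: real) (if l \<ge> 0 then 1 / c else 0)"
proof (cases "l \<ge> 0")
  case True
  have cell: "\<lfloor>c * x\<rfloor> = l \<longleftrightarrow> x \<in> {l / c..<(l + 1) / c}" for x
    using assms by (simp add: floor_eq_iff pos_divide_le_eq pos_less_divide_eq mult.commute)
  have pos: "x > 0 \<longleftrightarrow> x \<noteq> 0" if "x \<in> {l / c..<(l + 1) / c}" for x
  proof -
    have "0 \<le> l / c" using assms True by simp
    also have "l / c \<le> x" using that by simp
    finally show ?thesis by auto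
  qed
  \<comment> \<open>The open half-line removes at most the point 0 from the cell, a null
    set.\<close>
  have "(\<lambda>x. indicator {0<..} x * of_bool (\<lfloor>c * x\<rfloor> = l)) = (indicator ({l / c..<(l + 1) / c} - {0}) :: real \<Rightarrow> real)"
    unfolding cell using pos by (auto simp: fun_eq_iff indicator_def)
  moreover have "has_bochner_integral lborel (indicator ({l / c..<(l + 1) / c} - {0}) :: real \<Rightarrow> real)
     (measure lborel ({l / c..<(l + 1) / c} - {0}))"
    using True assms by (intro has_bochner_integral_real_indicator le_less_trans[OF emeasure_mono[OF Diff_subset]])
      (auto simp: divide_right_mono)
  moreover have "measure lborel ({l / c..<(l + 1) / c} - {0}) = measure lborel {l / c..<(l + 1) / c}"
    by (rule measure_Diff_null_set) auto
  moreover have "measure lborel {l / c..<(l + 1) / c} = 1 / c"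
    using assms by (subst measure_lborel_Ico) (auto simp: divide_simps)
  ultimately show ?thesis using True by simp
next
  case False
  have "\<not> (x > 0 \<and> \<lfloor>c * x\<rfloor> = l)" for x
    using assms False by (metis mult_pos_pos less_imp_le zero_le_floor)
  then have "(\<lambda>x. indicator {0<..} x * of_bool (\<lfloor>c * x\<rfloor> = l)) = (\<lambda>_. 0 :: real)"
    by (auto simp: fun_eq_iff indicator_def)
  then show ?thesis using False by (simp add: has_bochner_integral_zero)
qed

text \<open>Unit cells split the half-line, and the geometric series is integrated term by
  term.\<close>

lemma geometric_floor_integral:
  fixes z :: real
  assumes "0 < z" "z < 1"
  shows "has_bochner_integral lborel (\<lambda>x::real. indicator {0<..} x * z ^ nat \<lfloor>x\<rfloor>) (1 / (1 - z))"
proof -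
  let ?f = "\<lambda>l (x::real). z ^ l * (indicator {0<..} x * of_bool (\<lfloor>1 * x\<rfloor> = int l)) :: real"
  have hb: "has_bochner_integral lborel (?f l) (z ^ l)" for l
    using has_bochner_integral_mult_right[OF floor_cell_integral[of 1 "int l"], of "z ^ l"] by simp
  have single: "(\<lambda>l. ?f l x) sums (indicator {0<..} x * z ^ nat \<lfloor>x\<rfloor>)" for x
  proof (cases "x > 0")
    case True
    then have "?f l x = (if l = nat \<lfloor>x\<rfloor> then z ^ l else 0)" for l by (auto simp: indicator_def)
    then show ?thesis using True sums_single[of "nat \<lfloor>x\<rfloor>" "\<lambda>l. z ^ l"] by simp
  qed simp
  have nonneg: "norm (?f l x) = ?f l x" for l x using assms by (simp add: indicator_def)
  have geo: "(\<lambda>l. z ^ l) sums (1 / (1 - z))" using assms by (intro geometric_sums) simp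
  have suminf: "(\<lambda>x. \<Sum>l. ?f l x) = (\<lambda>x. indicator {0<..} x * z ^ nat \<lfloor>x\<rfloor>)"
    using single by (auto simp: sums_iff)
  have 1: "integrable lborel (?f l)" for l using hb[of l] by (rule integrable.intros)
  have 2: "AE x in lborel. summable (\<lambda>l. norm (?f l x))"
    unfolding nonneg using single by (auto simp: sums_iff)
  have int: "integral\<^sup>L lborel (?f l) = z ^ l" for l using hb[of l] by (rule has_bochner_integral_integral_eq)
  have 3: "summable (\<lambda>l. \<integral>x. norm (?f l x) \<partial>lborel)"
    unfolding nonneg int using geo by (simp add: sums_iff)
  have "integrable lborel (\<lambda>x::real. indicator {0<..} x * z ^ nat \<lfloor>x\<rfloor>)"
    using integrable_suminf[OF 1 2 3] unfolding suminf .
  moreover have "integral\<^sup>L lborel (\<lambda>x::real. indicator {0<..} x * z ^ nat \<lfloor>x\<rfloor>) = 1 / (1 - z)"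
    using integral_suminf[OF 1 2 3] unfolding suminf int using geo by (simp add: sums_iff)
  ultimately show ?thesis by (simp add: has_bochner_integral_iff)
qed

text \<open>Majorant for the directions in \<open>C\<close> of \<open>orthant_limit\<close>. The 2
  allows an error 1 between the integer threshold and the mean, and another 1 from rounding the
  offset down.\<close>

lemma integrable_exp_decay: "integrable lborel (\<lambda>x::real. indicator {0<..} x * exp (2 - x) :: real)"
proof (rule Bochner_Integration.integrable_bound)
  let ?g = "\<lambda>x::real. exp 3 * (indicator {0<..} x * exp (- 1) ^ nat \<lfloor>x\<rfloor>) :: real"
  show "integrable lborel ?g"
    using geometric_floor_integral[of "exp (- 1)"] by (intro integrable_mult_right) (auto simp: has_bochner_integral_iff)
  show "AE x in lborel. norm (indicator {0<..} x * exp (2 - x)) \<le> norm (?g x)"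
  proof (rule AE_I2)
    fix x :: real
    have "exp (2 - x) \<le> exp (3 - real (nat \<lfloor>x\<rfloor>))" if "x > 0"
    proof -
      have "real (nat \<lfloor>x\<rfloor>) \<le> x" using that by simp
      then show ?thesis by (simp del: of_nat_nat)
    qed
    then show "norm (indicator {0<..} x * exp (2 - x)) \<le> norm (?g x)"
      by (auto simp: indicator_def exp_diff exp_minus divide_inverse power_inverse simp flip: exp_of_nat_mult)
  qed
qed measurable

section \<open>Sums over lattice orthants\<close>

lemma prod_of_bool:
  "finite I \<Longrightarrow> (\<Prod>j\<in>I. of_bool (P j)) = (of_bool (\<forall>j\<in>I. P j) :: 'a :: comm_semiring_1)"
  by (induction I rule: finite_induct) auto

context lattice_walk
begin

text \<open>Kept as a sum over paths rather than over end points, so that the probability of the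
  event turns into it term by term.\<close>

definition orthant_sum :: "(nat \<Rightarrow> real) \<Rightarrow> nat \<Rightarrow> (nat \<Rightarrow> int) \<Rightarrow> real" where
  "orthant_sum \<zeta> n k = (\<Sum>v\<in>PiE {..<n} (\<lambda>_. R).
     if \<forall>j\<in>I. int (\<Sum>i<n. W (v i) j) \<le> k j
     then (\<Prod>i<n. q (v i)) * (\<Prod>j\<in>I. \<zeta> j ^ nat (k j - int (\<Sum>i<n. W (v i) j))) else 0)"

text \<open>\<open>x j\<close> is the distance of the end point below the threshold, measured in
  units of \<open>c j\<close> lattice steps.\<close>

definition layer :: "(nat \<Rightarrow> real) \<Rightarrow> (nat \<Rightarrow> real) \<Rightarrow> nat \<Rightarrow> (nat \<Rightarrow> int) \<Rightarrow> (nat \<Rightarrow> real) \<Rightarrow> real" where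
  "layer \<zeta> c n k x = (\<Prod>j\<in>I. indicator {0<..} (x j) * \<zeta> j ^ nat \<lfloor>x j\<rfloor>) *
     walk_prob R I W q n (\<lambda>j. k j - \<lfloor>c j * x j\<rfloor>)"

text \<open>The lattice sum becomes an integral over unit cells, stretched by \<open>1 / c j\<close> in direction \<open>j\<close>;
  a stretched direction must carry no geometric weight.\<close>

lemma layer_integral:
  assumes c: "\<And>j. j \<in> I \<Longrightarrow> c j > 0" "\<And>j. j \<in> I \<Longrightarrow> c j = 1 \<or> \<zeta> j = 1"
  shows "has_bochner_integral (PiM I (\<lambda>_. lborel)) (layer \<zeta> c n k) (orthant_sum \<zeta> n k / (\<Prod>j\<in>I. c j))"
proof -
  let ?V = "PiE {..<n} (\<lambda>_. R)"
  let ?N = "\<lambda>v j. int (\<Sum>i<n. W (v i) j)"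
  let ?h = "\<lambda>v j (x::real). \<zeta> j ^ nat (k j - ?N v j) * (indicator {0<..} x * of_bool (\<lfloor>c j * x\<rfloor> = k j - ?N v j)) :: real"
  let ?H = "\<lambda>v j. if ?N v j \<le> k j then \<zeta> j ^ nat (k j - ?N v j) / c j else 0"
  have h: "has_bochner_integral lborel (?h v j) (?H v j)" if "j \<in> I" for v j
    using has_bochner_integral_mult_right[OF floor_cell_integral[OF c(1)[OF that], of "k j - ?N v j"],
        of "\<zeta> j ^ nat (k j - ?N v j)"] by (auto split: if_splits)
  have hb: "has_bochner_integral (PiM I (\<lambda>_. lborel)) (\<lambda>x. \<Prod>j\<in>I. ?h v j (x j)) (\<Prod>j\<in>I. ?H v j)" for v
  proof -
    have i: "integrable lborel (?h v j)" "integral\<^sup>L lborel (?h v j) = ?H v j" if "j \<in> I" for j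
      using h[OF that, of v] by (simp_all only: has_bochner_integral_iff)
    have "(\<Prod>j\<in>I. integral\<^sup>L lborel (?h v j)) = (\<Prod>j\<in>I. ?H v j)"
      by (intro prod.cong refl i(2))
    then show ?thesis unfolding has_bochner_integral_iff
      using lborel_product.product_integral_prod[OF finite_I i(1)]
        lborel_product.product_integrable_prod[OF finite_I i(1)] by simp
  qed
  have layer: "layer \<zeta> c n k = (\<lambda>x. \<Sum>v\<in>?V. (\<Prod>i<n. q (v i)) * (\<Prod>j\<in>I. ?h v j (x j)))"
  proof
    fix x
    have "layer \<zeta> c n k x = (\<Sum>v\<in>?V. (\<Prod>i<n. q (v i)) *
        (\<Prod>j\<in>I. indicator {0<..} (x j) * \<zeta> j ^ nat \<lfloor>x j\<rfloor> * of_bool (\<lfloor>c j * x j\<rfloor> = k j - ?N v j)))"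
      unfolding layer_def walk_prob_def sum_distrib_left prod.distrib prod_of_bool[OF finite_I]
      by (intro sum.cong refl) (auto simp: algebra_simps)
    \<comment> \<open>On the cell, \<open>\<lfloor>x j\<rfloor>\<close> is the distance of the path
      below the threshold if \<open>c j = 1\<close>; otherwise \<open>\<zeta> j = 1\<close> and the
      exponent does not matter.\<close>
    also have "\<dots> = (\<Sum>v\<in>?V. (\<Prod>i<n. q (v i)) * (\<Prod>j\<in>I. ?h v j (x j)))"
    proof (rule sum.cong[OF refl], rule arg_cong2[where f = "(*)", OF refl], rule prod.cong[OF refl])
      fix v j assume "j \<in> I"
      then show "indicator {0<..} (x j) * \<zeta> j ^ nat \<lfloor>x j\<rfloor> * of_bool (\<lfloor>c j * x j\<rfloor> = k j - ?N v j) = ?h v j (x j)"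
        using c(2)[of j] by auto
    qed
    finally show "layer \<zeta> c n k x = (\<Sum>v\<in>?V. (\<Prod>i<n. q (v i)) * (\<Prod>j\<in>I. ?h v j (x j)))" .
  qed
  have H: "(\<Prod>j\<in>I. ?H v j) = (if \<forall>j\<in>I. ?N v j \<le> k j then (\<Prod>j\<in>I. \<zeta> j ^ nat (k j - ?N v j)) / (\<Prod>j\<in>I. c j) else 0)" for v
  proof (cases "\<forall>j\<in>I. ?N v j \<le> k j")
    case True
    then show ?thesis by (simp add: prod_dividef)
  next
    case False
    then show ?thesis using finite_I by (auto intro!: prod_zero)
  qed
  have "has_bochner_integral (PiM I (\<lambda>_. lborel)) (layer \<zeta> c n k) (\<Sum>v\<in>?V. (\<Prod>i<n. q (v i)) * (\<Prod>j\<in>I. ?H v j))"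
    unfolding layer by (intro has_bochner_integral_sum has_bochner_integral_mult_right hb)
  also have "(\<Sum>v\<in>?V. (\<Prod>i<n. q (v i)) * (\<Prod>j\<in>I. ?H v j)) = orthant_sum \<zeta> n k / (\<Prod>j\<in>I. c j)"
    unfolding H orthant_sum_def sum_divide_distrib by (intro sum.cong refl) auto
  finally show ?thesis .
qed

lemma walk_prob_nonneg: "walk_prob R I W q n a \<ge> 0"
proof -
  have "0 \<le> (\<Prod>i<n. q (v i))" if "v \<in> PiE {..<n} (\<lambda>_. R)" for v
    using PiE_mem[OF that] by (intro prod_nonneg) (simp add: less_imp_le q_pos)
  then show ?thesis unfolding walk_prob_def by (intro sum_nonneg) simp
qed

text \<open>Of the power n^(card I / 2) in the local limit theorem, the cells of width 1 / sqrt n in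
  the directions \<open>C\<close> use up n^(card C / 2). Outside \<open>C\<close> the offset from
  the threshold stays bounded and vanishes on the scale sqrt n, so only the \<open>C\<close>-block
  of the inverse covariance survives. Positivity of \<open>L\<close> is what later turns convergence
  into asymptotic equivalence.\<close>

lemma orthant_limit:
  fixes \<zeta> :: "nat \<Rightarrow> real" and k :: "nat \<Rightarrow> nat \<Rightarrow> int"
  assumes C: "C \<subseteq> I" "\<And>j. j \<in> C \<Longrightarrow> \<zeta> j = 1"
    and \<zeta>: "\<And>j. j \<in> I - C \<Longrightarrow> 0 < \<zeta> j \<and> \<zeta> j < 1"
    and k: "\<And>n j. j \<in> I \<Longrightarrow> \<bar>k n j - n * mean j\<bar> \<le> 1"
  defines "L \<equiv> (\<Prod>j\<in>I - C. 1 / (1 - \<zeta> j)) * ((LINT u : {u \<in> space (PiM C (\<lambda>_. lborel)). \<forall>j\<in>C. 0 < u j} | PiM C (\<lambda>_. lborel).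
             exp (- (\<Sum>i\<in>C. \<Sum>j\<in>C. u i * inverse_on I cov i j * u j) / 2)) / sqrt ((2 * pi) ^ card I * det_on I cov))"
  shows "(\<lambda>n. sqrt n ^ card (I - C) * orthant_sum \<zeta> n (k n)) \<longlonglongrightarrow> L" and "L > 0"
proof -
  let ?M = "PiM I (\<lambda>_. lborel) :: (nat \<Rightarrow> real) measure"
  let ?D = "sqrt ((2 * pi) ^ card I * det_on I cov)"
  let ?G = "\<lambda>u. exp (- (\<Sum>i\<in>C. \<Sum>j\<in>C. u i * inverse_on I cov i j * u j) / 2)"
  define g where "g j x = indicator {0<..} x * \<zeta> j ^ nat \<lfloor>x\<rfloor>" for j and x :: real
  define c where "c n j = (if j \<in> C then sqrt n else 1)" for n :: nat and j :: nat
  define f where "f n x = sqrt n ^ card I * layer \<zeta> (c n) n (k n) x" for n x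
  define F where "F x = (\<Prod>j\<in>I. g j (x j)) * (?G x / ?D)" for x
  obtain K where K: "K \<ge> 0"
    "\<And>n a. n > 0 \<Longrightarrow> sqrt n ^ card I * walk_prob R I W q n a \<le> K * (\<Prod>j\<in>I. exp (- \<bar>a j - n * mean j\<bar> / sqrt n))"
    using walk_prob_exp_le by blast
  \<comment> \<open>Geometric weights are integrable by themselves, so outside \<open>C\<close> the
    tail factor is estimated by 1; in \<open>C\<close> the tail factor has to supply the
    decay.\<close>
  define w where "w x = K * (\<Prod>j\<in>I. if j \<in> C then indicator {0<..} (x j) * exp (2 - x j) else g j (x j))" for x :: "nat \<Rightarrow> real"
  have finC: "finite C" using C(1) finite_I finite_subset by blast
  have det_pos: "det_on I cov > 0" by (rule sym_coercive_det_pos[OF finite_I cov_coercive])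
  have \<zeta>_nonneg: "\<zeta> j > 0" if "j \<in> I" for j using C(2)[of j] \<zeta>[of j] that by (cases "j \<in> C") auto
  have g_nonneg: "g j x \<ge> 0" if "j \<in> I" for j x using \<zeta>_nonneg[OF that] by (simp add: g_def)
  have g_int: "has_bochner_integral lborel (g j) (1 / (1 - \<zeta> j))" if "j \<in> I - C" for j
    unfolding g_def using geometric_floor_integral[of "\<zeta> j"] \<zeta>[OF that] by simp
  have fx: "f n x = (\<Prod>j\<in>I. g j (x j)) * (sqrt n ^ card I * walk_prob R I W q n (\<lambda>j. k n j - \<lfloor>c n j * x j\<rfloor>))" for n x
    by (simp add: f_def layer_def g_def)
  have f_nonneg: "f n x \<ge> 0" for n x
    unfolding fx by (intro mult_nonneg_nonneg prod_nonneg walk_prob_nonneg zero_le_power g_nonneg) auto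
  have f_int: "has_bochner_integral ?M (f n) (sqrt n ^ card (I - C) * orthant_sum \<zeta> n (k n))" if n: "n > 0" for n
  proof -
    have "has_bochner_integral ?M (layer \<zeta> (c n) n (k n)) (orthant_sum \<zeta> n (k n) / (\<Prod>j\<in>I. c n j))"
      by (rule layer_integral) (use n C(2) in \<open>auto simp: c_def\<close>)
    then have "has_bochner_integral ?M (f n) (sqrt n ^ card I * (orthant_sum \<zeta> n (k n) / (\<Prod>j\<in>I. c n j)))"
      unfolding f_def by (rule has_bochner_integral_mult_right)
    moreover have "(\<Prod>j\<in>I. c n j) = sqrt n ^ card C"
      using C(1) finite_I unfolding c_def by (subst prod.inter_restrict[symmetric]) (auto simp: Int_absorb1)
    moreover have "card I = card (I - C) + card C"
      using C(1) finite_I finC by (metis card_Diff_subset card_mono le_add_diff_inverse2)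
    ultimately show ?thesis using n by (simp add: power_add)
  qed
  have dominated: "norm (f n x) \<le> w x" if n: "n > 0" for n x
  proof -
    let ?a = "\<lambda>j. k n j - \<lfloor>c n j * x j\<rfloor>"
    let ?e = "\<lambda>j. exp (- \<bar>?a j - n * mean j\<bar> / sqrt n)"
    have "f n x \<le> (\<Prod>j\<in>I. g j (x j)) * (K * (\<Prod>j\<in>I. ?e j))"
      unfolding fx by (intro mult_left_mono[OF K(2)[OF n]] prod_nonneg g_nonneg)
    also have "\<dots> = K * (\<Prod>j\<in>I. g j (x j) * ?e j)" by (simp add: prod.distrib)
    also have "\<dots> \<le> w x" unfolding w_def
    proof (rule mult_left_mono[OF _ K(1)], rule prod_mono, rule conjI)
      fix j assume j: "j \<in> I"
      show "0 \<le> g j (x j) * ?e j" using g_nonneg[OF j] by simp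
      show "g j (x j) * ?e j \<le> (if j \<in> C then indicator {0<..} (x j) * exp (2 - x j) else g j (x j))"
      proof (cases "j \<in> C")
        case True
        have "?e j \<le> exp (2 - x j)"
        proof -
          have "sqrt n * x j - 2 \<le> \<bar>?a j - n * mean j\<bar>"
          proof -
            have "sqrt n * x j - 1 \<le> real_of_int \<lfloor>c n j * x j\<rfloor>"
              using True unfolding c_def by simp
            then show ?thesis using k[OF j, of n] unfolding of_int_diff by linarith
          qed
          then have "- \<bar>?a j - n * mean j\<bar> / sqrt n \<le> (2 - sqrt n * x j) / sqrt n"
            using n by (intro divide_right_mono) auto
          also have "\<dots> = 2 / sqrt n - x j" using n by (simp add: diff_divide_distrib)
          also have "2 / sqrt n \<le> 2 / 1" using n by (intro divide_left_mono) auto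
          finally show ?thesis by simp
        qed
        then show ?thesis using True C(2) by (simp add: g_def indicator_def)
      next
        case False
        have "?e j \<le> 1" by simp
        then have "g j (x j) * ?e j \<le> g j (x j) * 1" by (rule mult_left_mono[OF _ g_nonneg[OF j]])
        then show ?thesis using False by simp
      qed
    qed
    finally show ?thesis using f_nonneg by simp
  qed
  have w_int: "integrable ?M w"
    unfolding w_def
  proof (intro integrable_mult_right lborel_product.product_integrable_prod finite_I)
    fix j assume "j \<in> I"
    then show "integrable lborel (\<lambda>x. if j \<in> C then indicator {0<..} x * exp (2 - x) else g j x)"
      using g_int[of j] integrable_exp_decay by (cases "j \<in> C") (auto simp: has_bochner_integral_iff)
  qed
  have lim: "(\<lambda>n. f n x) \<longlonglongrightarrow> F x" for x
  proof -
    \<comment> \<open>Limit of the rescaled end point relative to the mean: below the threshold in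
      \<open>C\<close>, hence the minus sign, and indistinguishable from it elsewhere.\<close>
    define X where "X j = (if j \<in> C then - x j else 0)" for j
    define y where "y i = (\<Sum>l\<in>I. inverse_on I cov i l * X l)" for i
    have "(\<lambda>n. (k n j - \<lfloor>c n j * x j\<rfloor> - n * mean j) / sqrt n) \<longlonglongrightarrow> X j" if j: "j \<in> I" for j
    proof (rule LIM_zero_cancel, rule Lim_null_comparison)
      have "(\<lambda>n::nat. (2 + \<bar>\<lfloor>x j\<rfloor>\<bar>) * (1 / sqrt n)) \<longlonglongrightarrow> real_of_int (2 + \<bar>\<lfloor>x j\<rfloor>\<bar>) * 0"
        by (intro tendsto_mult tendsto_const) real_asymp
      then show "(\<lambda>n::nat. (2 + \<bar>\<lfloor>x j\<rfloor>\<bar>) * (1 / sqrt n)) \<longlonglongrightarrow> 0" by simp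
      \<comment> \<open>The threshold accounts for an error 1; the rest is the rounding error in
        \<open>C\<close> and the fixed offset \<open>\<lfloor>x j\<rfloor>\<close>
        elsewhere.\<close>
      show "\<forall>\<^sub>F n in sequentially. norm ((k n j - \<lfloor>c n j * x j\<rfloor> - n * mean j) / sqrt n - X j)
          \<le> (2 + \<bar>\<lfloor>x j\<rfloor>\<bar>) * (1 / sqrt n)"
        using eventually_gt_at_top[of 0]
      proof eventually_elim
        case (elim n)
        have "(k n j - \<lfloor>c n j * x j\<rfloor> - n * mean j) / sqrt n - X j
            = (k n j - \<lfloor>c n j * x j\<rfloor> - n * mean j - sqrt n * X j) / sqrt n"
          using elim by (simp add: diff_divide_distrib)
        moreover have "\<bar>k n j - \<lfloor>c n j * x j\<rfloor> - n * mean j - sqrt n * X j\<bar> \<le> 2 + \<bar>\<lfloor>x j\<rfloor>\<bar>"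
          using k[OF j, of n] unfolding c_def X_def by (cases "j \<in> C"; simp; linarith)
        ultimately show ?case using elim by (simp add: divide_right_mono)
      qed
    qed
    then have x': "(\<lambda>n. ((k n j - \<lfloor>c n j * x j\<rfloor>) - n * mean j) / sqrt n) \<longlonglongrightarrow> X j" if "j \<in> I" for j
      using that by simp
    have y': "(\<Sum>j\<in>I. cov i j * y j) = X i" if i: "i \<in> I" for i
    proof -
      have "(\<Sum>j\<in>I. cov i j * y j) = (\<Sum>l\<in>I. (\<Sum>j\<in>I. cov i j * inverse_on I cov j l) * X l)"
        unfolding y_def sum_distrib_left sum_distrib_right by (subst sum.swap) (simp add: mult.assoc)
      also have "\<dots> = (\<Sum>l\<in>I. if i = l then X l else 0)"
        by (intro sum.cong refl) (simp add: inverse_on_right[OF finite_I cov_coercive i])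
      finally show ?thesis using i finite_I by simp
    qed
    have quad: "(\<Sum>i\<in>I. X i * y i) = (\<Sum>i\<in>C. \<Sum>j\<in>C. x i * inverse_on I cov i j * x j)"
    proof -
      have "(\<Sum>i\<in>I. X i * y i) = (\<Sum>i\<in>C. X i * y i)"
        using C(1) finite_I by (intro sum.mono_neutral_right) (auto simp: X_def)
      also have "\<dots> = (\<Sum>i\<in>C. \<Sum>j\<in>C. x i * inverse_on I cov i j * x j)"
      proof (intro sum.cong refl)
        fix i assume i: "i \<in> C"
        have "y i = (\<Sum>l\<in>C. inverse_on I cov i l * X l)"
          unfolding y_def using C(1) finite_I by (intro sum.mono_neutral_right) (auto simp: X_def)
        then show "X i * y i = (\<Sum>j\<in>C. x i * inverse_on I cov i j * x j)"
          using i by (simp add: X_def sum_distrib_left mult.assoc sum_negf)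
      qed
      finally show ?thesis .
    qed
    have "(\<lambda>n. sqrt n ^ card I * walk_prob R I W q n (\<lambda>j. k n j - \<lfloor>c n j * x j\<rfloor>)) \<longlonglongrightarrow> ?G x / ?D"
      using local_limit[of "\<lambda>n j. k n j - \<lfloor>c n j * x j\<rfloor>" X y] x' y' unfolding quad by simp
    then show ?thesis unfolding fx F_def by (rule tendsto_mult_left)
  qed
  have f_meas: "f (Suc n) \<in> borel_measurable ?M" for n
    by (rule borel_measurable_integrable[OF integrable.intros[OF f_int[OF zero_less_Suc]]])
  have F_meas: "F \<in> borel_measurable ?M"
  proof (rule borel_measurable_LIMSEQ_real)
    show "(\<lambda>n. f (Suc n) x) \<longlonglongrightarrow> F x" for x using lim[of x] by (rule LIMSEQ_Suc)
  qed (rule f_meas)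
  have lim_AE: "AE x in ?M. (\<lambda>n. f (Suc n) x) \<longlonglongrightarrow> F x"
    by (intro AE_I2 LIMSEQ_Suc lim)
  have dom_AE: "AE x in ?M. norm (f (Suc n) x) \<le> w x" for n
    by (intro AE_I2 dominated) simp
  have F_int: "integrable ?M F"
    by (rule integrable_dominated_convergence[OF F_meas f_meas w_int lim_AE dom_AE])
  have "integral\<^sup>L ?M (f (Suc n)) = sqrt (Suc n) ^ card (I - C) * orthant_sum \<zeta> (Suc n) (k (Suc n))" for n
    by (rule has_bochner_integral_integral_eq[OF f_int[OF zero_less_Suc]])
  with integral_dominated_convergence[OF F_meas f_meas w_int lim_AE dom_AE]
  have "(\<lambda>n. sqrt (Suc n) ^ card (I - C) * orthant_sum \<zeta> (Suc n) (k (Suc n))) \<longlonglongrightarrow> integral\<^sup>L ?M F"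
    by (simp only:)
  then have lim_F: "(\<lambda>n. sqrt n ^ card (I - C) * orthant_sum \<zeta> n (k n)) \<longlonglongrightarrow> integral\<^sup>L ?M F"
    by (rule LIMSEQ_imp_Suc)
  have D_pos: "?D > 0" using det_pos by simp
  have F_pos: "F x > 0" if "\<And>j. j \<in> I \<Longrightarrow> x j > 0" for x
  proof -
    have "g j (x j) > 0" if j: "j \<in> I" for j
      using \<zeta>_nonneg[OF j] \<open>\<And>j. j \<in> I \<Longrightarrow> x j > 0\<close>[OF j] by (simp add: g_def)
    then show ?thesis
      unfolding F_def by (intro mult_pos_pos prod_pos divide_pos_pos exp_gt_zero D_pos)
  qed
  have F_nonneg: "F x \<ge> 0" for x
    unfolding F_def by (intro mult_nonneg_nonneg prod_nonneg g_nonneg divide_nonneg_pos exp_ge_zero D_pos)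
  \<comment> \<open>\<open>F\<close> is positive on the open unit cube, which has measure 1.\<close>
  have "integral\<^sup>L ?M F \<noteq> 0"
  proof
    assume "integral\<^sup>L ?M F = 0"
    then have "AE x in ?M. F x = 0"
      using integral_nonneg_eq_0_iff_AE[OF F_int] F_nonneg by simp
    then have "AE x in ?M. x \<notin> PiE I (\<lambda>_. {0<..<1})"
    proof eventually_elim
      case (elim x)
      show ?case
      proof
        assume x: "x \<in> PiE I (\<lambda>_. {0<..<1})"
        have "F x > 0" by (rule F_pos) (use PiE_mem[OF x] in simp)
        then show False using elim by simp
      qed
    qed
    moreover have "PiE I (\<lambda>_. {0<..<1}) \<in> sets ?M"
      using finite_I by (intro sets_PiM_I_finite) auto
    ultimately have "emeasure ?M (PiE I (\<lambda>_. {0<..<1})) = 0"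
      by (subst (asm) AE_iff_null_sets[symmetric]) auto
    moreover have "emeasure ?M (PiE I (\<lambda>_. {0<..<1})) = (\<Prod>j\<in>I. emeasure lborel {0<..<1::real})"
      using finite_I by (intro lborel_product.emeasure_PiM) auto
    ultimately show False by simp
  qed
  moreover have "integral\<^sup>L ?M F \<ge> 0" using F_nonneg by simp
  ultimately have "integral\<^sup>L ?M F > 0" by simp
  moreover have "integral\<^sup>L ?M F = L"
  proof -
    let ?MC = "PiM C (\<lambda>_. lborel) :: (nat \<Rightarrow> real) measure"
    let ?A = "{u \<in> space ?MC. \<forall>j\<in>C. 0 < u j}"
    have IC: "(I - C) \<union> C = I" using C(1) by auto
    have F_merge: "F (merge (I - C) C (x, u)) = (\<Prod>j\<in>I - C. g j (x j)) * (indicator ?A u *\<^sub>R ?G u / ?D)"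
      if u: "u \<in> space ?MC" for x u
    proof -
      have "(\<Prod>j\<in>I. g j (merge (I - C) C (x, u) j)) = (\<Prod>j\<in>I - C. g j (merge (I - C) C (x, u) j)) * (\<Prod>j\<in>C. g j (merge (I - C) C (x, u) j))"
        using C(1) finite_I by (simp add: prod.subset_diff)
      also have "(\<Prod>j\<in>I - C. g j (merge (I - C) C (x, u) j)) = (\<Prod>j\<in>I - C. g j (x j))"
        by (intro prod.cong refl) (simp add: merge_def)
      also have "(\<Prod>j\<in>C. g j (merge (I - C) C (x, u) j)) = (\<Prod>j\<in>C. of_bool (0 < u j))"
        by (intro prod.cong refl) (simp add: merge_def g_def C(2))
      also have "\<dots> = indicator ?A u"
        using u finC by (simp add: prod_of_bool indicator_def)
      finally have "(\<Prod>j\<in>I. g j (merge (I - C) C (x, u) j)) = (\<Prod>j\<in>I - C. g j (x j)) * indicator ?A u" .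
      moreover have "?G (merge (I - C) C (x, u)) = ?G u"
        by (intro arg_cong[where f = "\<lambda>s. exp (- s / 2)"] sum.cong refl) (simp add: merge_def)
      ultimately show ?thesis unfolding F_def by simp
    qed
    have "integral\<^sup>L ?M F = (\<integral>x. (\<integral>u. F (merge (I - C) C (x, u)) \<partial>?MC) \<partial>PiM (I - C) (\<lambda>_. lborel))"
      using lborel_product.product_integral_fold[of "I - C" C F] F_int finite_I finC
      unfolding IC by (simp add: Diff_disjoint Int_commute)
    also have "\<dots> = (\<integral>x. (\<Prod>j\<in>I - C. g j (x j)) * ((LINT u:?A|?MC. ?G u) / ?D) \<partial>PiM (I - C) (\<lambda>_. lborel))"
    proof (intro Bochner_Integration.integral_cong refl)
      fix x
      have "(\<integral>u. F (merge (I - C) C (x, u)) \<partial>?MC) = (\<integral>u. (\<Prod>j\<in>I - C. g j (x j)) * (indicator ?A u *\<^sub>R ?G u / ?D) \<partial>?MC)"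
        by (intro Bochner_Integration.integral_cong refl F_merge)
      then show "(\<integral>u. F (merge (I - C) C (x, u)) \<partial>?MC) = (\<Prod>j\<in>I - C. g j (x j)) * ((LINT u:?A|?MC. ?G u) / ?D)"
        unfolding integral_mult_right_zero integral_divide_zero set_lebesgue_integral_def .
    qed
    also have "\<dots> = (\<Prod>j\<in>I - C. integral\<^sup>L lborel (g j)) * ((LINT u:?A|?MC. ?G u) / ?D)"
      unfolding integral_mult_left_zero
      using g_int finite_I by (subst lborel_product.product_integral_prod) (auto simp: has_bochner_integral_iff)
    also have "(\<Prod>j\<in>I - C. integral\<^sup>L lborel (g j)) = (\<Prod>j\<in>I - C. 1 / (1 - \<zeta> j))"
      using g_int by (intro prod.cong refl) (auto simp: has_bochner_integral_iff)
    finally show ?thesis unfolding L_def .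
  qed
  ultimately show "(\<lambda>n. sqrt n ^ card (I - C) * orthant_sum \<zeta> n (k n)) \<longlonglongrightarrow> L" "L > 0"
    using lim_F by simp_all
qed

end

section \<open>Rankings and saddle points\<close>

text \<open>The Hessian and \<open>cov\<close> are compared only on the index set, and the
  description in \<open>inverse_on\<close> looks at no other entries.\<close>

lemma inverse_on_cong:
  assumes "\<And>i j. i \<in> I \<Longrightarrow> j \<in> I \<Longrightarrow> M i j = N i j"
  shows "inverse_on I M = inverse_on I N"
proof -
  have "(\<Sum>k\<in>I. M i k * f k) = (\<Sum>k\<in>I. N i k * f k)" if "i \<in> I" for i f
    using that assms by (intro sum.cong) auto
  moreover have "(\<Sum>k\<in>I. f k * M k j) = (\<Sum>k\<in>I. f k * N k j)" if "j \<in> I" for j f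
    using that assms by (intro sum.cong) auto
  ultimately show ?thesis unfolding inverse_on_def
    by (intro arg_cong[where f = The] ext conj_cong ball_cong refl) simp_all
qed

section \<open>Derivatives of the cumulant generating function\<close>

definition mgf :: "'r set \<Rightarrow> nat set \<Rightarrow> ('r \<Rightarrow> nat \<Rightarrow> nat) \<Rightarrow> ('r \<Rightarrow> real) \<Rightarrow> (nat \<Rightarrow> real) \<Rightarrow> real" where
  "mgf R I W p t = (\<Sum>r\<in>R. p r * exp (\<Sum>l\<in>I. t l * W r l))"

definition tilted_mean ::
  "'r set \<Rightarrow> nat set \<Rightarrow> ('r \<Rightarrow> nat \<Rightarrow> nat) \<Rightarrow> ('r \<Rightarrow> real) \<Rightarrow> (nat \<Rightarrow> real) \<Rightarrow> nat \<Rightarrow> real" where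
  "tilted_mean R I W p t j = mgf R I W (\<lambda>r. p r * W r j) t / mgf R I W p t"

lemma mgf_pos:
  assumes "finite R" "R \<noteq> {}" "\<And>r. r \<in> R \<Longrightarrow> p r > 0"
  shows "mgf R I W p t > 0"
  unfolding mgf_def using assms by (intro sum_pos) auto

text \<open>Differentiation multiplies the weight by a coordinate of \<open>W\<close>, so every
  derivative is again an \<open>mgf\<close>. This is why the weight is a parameter of
  \<open>mgf\<close>.\<close>

lemma mgf_has_partial_derivative:
  assumes "finite I" "i \<in> I"
  shows "((\<lambda>s. mgf R I W p (t(i := s))) has_real_derivative mgf R I W (\<lambda>r. p r * W r i) t) (at (t i))"
proof -
  have "(\<Sum>l\<in>I. (t(i := s)) l * W r l) = (\<Sum>l\<in>I. t l * W r l) + (s - t i) * W r i" for s r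
  proof -
    have "(\<Sum>l\<in>I. (t(i := s)) l * W r l) - (\<Sum>l\<in>I. t l * W r l) = (\<Sum>l\<in>I. if l = i then (s - t i) * W r i else 0)"
      unfolding sum_subtractf[symmetric] by (intro sum.cong) (auto simp: algebra_simps)
    then show ?thesis using assms by simp
  qed
  then have "(\<lambda>s. mgf R I W p (t(i := s))) = (\<lambda>s. \<Sum>r\<in>R. p r * exp ((\<Sum>l\<in>I. t l * W r l) + (s - t i) * W r i))"
    unfolding mgf_def by simp
  moreover have "((\<lambda>s. \<Sum>r\<in>R. p r * exp ((\<Sum>l\<in>I. t l * W r l) + (s - t i) * W r i)) has_real_derivative
      (\<Sum>r\<in>R. p r * (exp ((\<Sum>l\<in>I. t l * W r l) + (t i - t i) * W r i) * W r i))) (at (t i))"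
    by (auto intro!: derivative_eq_intros simp: mult_ac)
  ultimately show ?thesis by (simp add: mgf_def mult_ac)
qed

lemma ln_mgf_has_partial_derivative:
  assumes "finite I" "i \<in> I" "mgf R I W p t > 0"
  shows "((\<lambda>s. ln (mgf R I W p (t(i := s)))) has_real_derivative tilted_mean R I W p t i) (at (t i))"
  using assms by (auto intro!: derivative_eq_intros mgf_has_partial_derivative simp: tilted_mean_def)

lemma hessian_ln_mgf:
  assumes "finite I" "i \<in> I" "j \<in> I" "\<And>t. mgf R I W p t > 0"
  shows "hessian (\<lambda>t. ln (mgf R I W p t)) t i j =
    mgf R I W (\<lambda>r. p r * W r i * W r j) t / mgf R I W p t - tilted_mean R I W p t i * tilted_mean R I W p t j"
proof -
  let ?Z = "mgf R I W p"
  have "partial_deriv j (\<lambda>t. ln (?Z t)) = (\<lambda>t. tilted_mean R I W p t j)"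
    unfolding partial_deriv_def by (intro ext DERIV_imp_deriv ln_mgf_has_partial_derivative assms)
  moreover have "((\<lambda>s. tilted_mean R I W p (t(i := s)) j) has_real_derivative
     (mgf R I W (\<lambda>r. p r * W r j * W r i) t * ?Z t - mgf R I W (\<lambda>r. p r * W r j) t * mgf R I W (\<lambda>r. p r * W r i) t) / (?Z t * ?Z t)) (at (t i))"
    unfolding tilted_mean_def
    using DERIV_divide[OF mgf_has_partial_derivative[OF assms(1,2), of R W "\<lambda>r. p r * W r j" t]
        mgf_has_partial_derivative[OF assms(1,2), of R W p t]] assms(4)[of t] by simp
  ultimately have "hessian (\<lambda>t. ln (?Z t)) t i j =
     (mgf R I W (\<lambda>r. p r * W r j * W r i) t * ?Z t - mgf R I W (\<lambda>r. p r * W r j) t * mgf R I W (\<lambda>r. p r * W r i) t) / (?Z t * ?Z t)"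
    unfolding hessian_def by (simp add: partial_deriv_def DERIV_imp_deriv)
  then show ?thesis
    using assms(4)[of t] by (simp add: tilted_mean_def diff_divide_distrib mult_ac)
qed

text \<open>\<open>step m X\<close> records a ranking by the bits whose sums \<open>N j\<close> must stay below the thresholds:
  \<open>j\<close> above \<open>m\<close> for \<open>j \<in> X\<close>, and \<open>m\<close> above \<open>j\<close> otherwise.\<close>

definition step :: "nat \<Rightarrow> nat set \<Rightarrow> nat list \<Rightarrow> nat \<Rightarrow> nat" where
  "step m X r j = (if j \<in> X then of_bool (ranks_above r j m) else of_bool (ranks_above r m j))"

section \<open>Rankings and the candidates above and below m\<close>

lemma ranks_above_total:
  assumes "distinct r" "a \<in> set r" "b \<in> set r" "a \<noteq> b"
  shows "ranks_above r a b \<longleftrightarrow> \<not> ranks_above r b a"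
proof -
  obtain i j where ij: "i < length r" "r ! i = a" "j < length r" "r ! j = b"
    using assms(2,3) by (metis in_set_conv_nth)
  have above: "ranks_above r a b \<longleftrightarrow> i < j" "ranks_above r b a \<longleftrightarrow> j < i"
    using ij assms(1) unfolding ranks_above_def by (auto simp: nth_eq_iff_index_eq)
  have "i \<noteq> j" using ij assms(4) by auto
  then show ?thesis unfolding above by auto
qed

lemma rankings_above_total:
  assumes "m \<ge> 2" "r \<in> rankings m" "j \<in> adversaries m"
  shows "ranks_above r m j \<longleftrightarrow> \<not> ranks_above r j m"
  using assms by (intro ranks_above_total) (auto simp: rankings_def permutations_of_set_def adversaries_def)

text \<open>Place A before m and the other adversaries after it. As every ranking has positive
  probability, every bit pattern is a possible step of the walk.\<close>

lemma ranking_with_above_set: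
  assumes "m \<ge> 2" "A \<subseteq> adversaries m"
  obtains r where "r \<in> rankings m" "\<And>j. j \<in> adversaries m \<Longrightarrow> ranks_above r j m \<longleftrightarrow> j \<in> A"
proof -
  have fin: "finite (adversaries m)" by (simp add: adversaries_def)
  obtain xs where xs: "set xs = A" "distinct xs"
    using finite_distinct_list finite_subset[OF assms(2) fin] by blast
  obtain ys where ys: "set ys = adversaries m - A" "distinct ys"
    using finite_distinct_list fin by (metis finite_Diff)
  let ?r = "xs @ m # ys"
  have m: "m \<notin> adversaries m" "insert m (adversaries m) = {1..m}" using assms(1) by (auto simp: adversaries_def)
  have r: "?r \<in> rankings m"
    unfolding rankings_def permutations_of_set_def using xs ys assms(2) m by auto
  have "ranks_above ?r j m \<longleftrightarrow> j \<in> A" if j: "j \<in> adversaries m" for j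
  proof (cases "j \<in> A")
    case True
    then obtain i where "i < length xs" "xs ! i = j" using xs by (metis in_set_conv_nth)
    then have "ranks_above ?r j m"
      unfolding ranks_above_def by (intro exI[of _ i] exI[of _ "length xs"]) (auto simp: nth_append)
    then show ?thesis using True by simp
  next
    case False
    then obtain i where "i < length ys" "ys ! i = j" using ys j by (metis DiffI in_set_conv_nth)
    then have "ranks_above ?r m j"
      unfolding ranks_above_def by (intro exI[of _ "length xs"] exI[of _ "Suc (length xs + i)"]) (auto simp: nth_append)
    then show ?thesis using False rankings_above_total[OF assms(1) r j] by simp
  qed
  then show thesis using that r by blast
qed

lemma finite_rankings: "finite (rankings m)"
  by (simp add: rankings_def)

lemma polyP_eq_sum_rankings:
  "polyP m p x = (\<Sum>r\<in>rankings m. p r * (\<Prod>j | j \<in> adversaries m \<and> ranks_above r j m. x j))"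
proof -
  let ?Z = "\<lambda>r. {j \<in> adversaries m. ranks_above r j m}"
  have "polyP m p x = (\<Sum>Z\<in>Pow (adversaries m). \<Sum>r\<in>{r \<in> rankings m. ?Z r = Z}. p r * (\<Prod>j\<in>?Z r. x j))"
    unfolding polyP_def pZ_def sum_distrib_right by (intro sum.cong) auto
  also have "\<dots> = (\<Sum>r\<in>rankings m. p r * (\<Prod>j\<in>?Z r. x j))"
    by (rule sum.group) (auto simp: finite_rankings adversaries_def)
  finally show ?thesis .
qed

text \<open>For j in Y the prefactor \<open>w j\<close> cancels against \<open>1 / w j\<close> when
  j is above m, so it survives exactly when m is above j: passing to \<open>polyPXY\<close> flips
  the bits on Y.\<close>

lemma polyPXY_exp:
  assumes "m \<ge> 2" "X \<subseteq> adversaries m" "Y \<subseteq> adversaries m" "X \<inter> Y = {}"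
  shows "polyPXY m p X Y (\<lambda>j. exp (t j)) = mgf (rankings m) (X \<union> Y) (step m X) p t"
proof -
  let ?x = "\<lambda>j. if j \<in> X then exp (t j) else if j \<in> Y then 1 / exp (t j) else 1"
  have fin: "finite (adversaries m)" by (simp add: adversaries_def)
  then have finXY: "finite X" "finite Y" using assms(2,3) by (auto intro: finite_subset)
  have "(\<Prod>j\<in>Y. exp (t j)) * (\<Prod>j | j \<in> adversaries m \<and> ranks_above r j m. ?x j)
      = exp (\<Sum>l\<in>X \<union> Y. t l * step m X r l)" if r: "r \<in> rankings m" for r
  proof -
    let ?b = "\<lambda>j. if ranks_above r j m then ?x j else 1"
    have "(\<Prod>j | j \<in> adversaries m \<and> ranks_above r j m. ?x j) = (\<Prod>j\<in>adversaries m. ?b j)"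
      by (rule prod.inter_filter) (rule fin)
    also have "\<dots> = (\<Prod>j\<in>X \<union> Y. ?b j)"
      using assms fin by (intro prod.mono_neutral_right) auto
    also have "\<dots> = (\<Prod>j\<in>X. ?b j) * (\<Prod>j\<in>Y. ?b j)"
      using assms finXY by (intro prod.union_disjoint) auto
    finally have "(\<Prod>j\<in>Y. exp (t j)) * (\<Prod>j | j \<in> adversaries m \<and> ranks_above r j m. ?x j)
       = (\<Prod>j\<in>X. ?b j) * (\<Prod>j\<in>Y. exp (t j) * ?b j)" by (simp add: prod.distrib)
    also have "(\<Prod>j\<in>X. ?b j) = (\<Prod>j\<in>X. exp (t j * step m X r j))"
      by (intro prod.cong) (auto simp: step_def)
    also have "(\<Prod>j\<in>Y. exp (t j) * ?b j) = (\<Prod>j\<in>Y. exp (t j * step m X r j))"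
    proof (intro prod.cong refl)
      fix j assume j: "j \<in> Y"
      then have "j \<notin> X" "j \<in> adversaries m" using assms by auto
      then show "exp (t j) * ?b j = exp (t j * step m X r j)"
        using j rankings_above_total[OF assms(1) r] by (simp add: step_def)
    qed
    also have "(\<Prod>j\<in>X. exp (t j * step m X r j)) * (\<Prod>j\<in>Y. exp (t j * step m X r j)) = (\<Prod>j\<in>X \<union> Y. exp (t j * step m X r j))"
      using assms finXY by (intro prod.union_disjoint[symmetric]) auto
    also have "\<dots> = exp (\<Sum>l\<in>X \<union> Y. t l * step m X r l)"
      using finXY by (intro exp_sum[symmetric]) auto
    finally show ?thesis .
  qed
  note prods = this
  show ?thesis
    unfolding polyPXY_def polyP_eq_sum_rankings mgf_def sum_distrib_left
  proof (intro sum.cong refl)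
    fix r assume "r \<in> rankings m"
    from prods[OF this] show "(\<Prod>j\<in>Y. exp (t j)) * (p r * (\<Prod>j | j \<in> adversaries m \<and> ranks_above r j m. ?x j))
       = p r * exp (\<Sum>l\<in>X \<union> Y. t l * step m X r l)"
      by (simp only: mult.left_commute[of _ "p r"])
  qed
qed

text \<open>For j in X the step sum is n minus the number of voters with m above j. The strict
  inequality puts it strictly below (1 - \<alpha> j) n, which for an integer means at most the
  ceiling minus 1. On Y the inequality is weak, and the floor appears.\<close>

lemma event_XY_iff_steps:
  assumes "m \<ge> 2" "X \<subseteq> adversaries m" "Y \<subseteq> adversaries m" "X \<inter> Y = {}"
    and v: "v \<in> PiE {..<n} (\<lambda>_. rankings m)"
  shows "event_XY m \<alpha> n X Y v \<longleftrightarrow> (\<forall>j\<in>X \<union> Y. int (\<Sum>i<n. step m X (v i) j)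
     \<le> (if j \<in> X then \<lceil>(1 - \<alpha> j) * n\<rceil> - 1 else \<lfloor>\<alpha> j * n\<rfloor>))"
proof -
  have num: "num_m_above m n v j = (\<Sum>i<n. of_bool (ranks_above (v i) m j))" for j
  proof -
    have "(\<Sum>i<n. of_bool (ranks_above (v i) m j)) = card ({..<n} \<inter> {i. ranks_above (v i) m j})"
      by (simp add: sum_of_bool_eq)
    then show ?thesis unfolding num_m_above_def by (simp add: Int_def)
  qed
  have X: "real (num_m_above m n v j) > \<alpha> j * n \<longleftrightarrow> int (\<Sum>i<n. step m X (v i) j) \<le> \<lceil>(1 - \<alpha> j) * n\<rceil> - 1"
    if j: "j \<in> X" for j
  proof -
    have "num_m_above m n v j + (\<Sum>i<n. step m X (v i) j) = (\<Sum>i<n. 1)"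
      unfolding num sum.distrib[symmetric]
    proof (intro sum.cong refl)
      fix i assume "i \<in> {..<n}"
      then have "v i \<in> rankings m" using v by auto
      then show "of_bool (ranks_above (v i) m j) + step m X (v i) j = 1"
        using j assms rankings_above_total[of m "v i" j] by (auto simp: step_def)
    qed
    then have "num_m_above m n v j + (\<Sum>i<n. step m X (v i) j) = n" by simp
    from arg_cong[OF this, of real]
    have "real (num_m_above m n v j) = n - real (\<Sum>i<n. step m X (v i) j)"
      unfolding of_nat_add by linarith
    then have "real (num_m_above m n v j) > \<alpha> j * n \<longleftrightarrow> real (\<Sum>i<n. step m X (v i) j) < (1 - \<alpha> j) * n"
      unfolding left_diff_distrib mult_1 by (intro iffI) linarith+
    also have "\<dots> \<longleftrightarrow> int (\<Sum>i<n. step m X (v i) j) < \<lceil>(1 - \<alpha> j) * n\<rceil>"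
      by (simp only: less_ceiling_iff of_int_of_nat_eq)
    finally show ?thesis by linarith
  qed
  have Y: "real (num_m_above m n v j) \<le> \<alpha> j * n \<longleftrightarrow> int (\<Sum>i<n. step m X (v i) j) \<le> \<lfloor>\<alpha> j * n\<rfloor>"
    if j: "j \<in> Y" for j
  proof -
    have "j \<notin> X" using j assms by auto
    then have "num_m_above m n v j = (\<Sum>i<n. step m X (v i) j)" by (simp add: num step_def)
    then show ?thesis by (simp only: le_floor_iff of_int_of_nat_eq)
  qed
  have "j \<notin> X" if "j \<in> Y" for j using that assms(4) by auto
  then show ?thesis unfolding event_XY_def ball_Un using X Y by simp
qed

theorem theorem8:
  fixes m :: nat and p :: "nat list \<Rightarrow> real" and \<alpha> :: "nat \<Rightarrow> real"
    and X Y S C :: "nat set" and \<tau> :: "nat \<Rightarrow> real"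
  defines "\<zeta> \<equiv> (\<lambda>j. exp (\<tau> j))"
    and "\<beta> \<equiv> (\<lambda>j. 1 - \<alpha> j)"
    and "H \<equiv> hessian (Ktilde m p X Y) \<tau>"
  assumes m2: "m \<ge> 2"
    and p_pos: "\<forall>r \<in> rankings m. p r > 0"
    and p_sum: "(\<Sum>r \<in> rankings m. p r) = 1"
    and alpha: "\<forall>j \<in> adversaries m. 0 < \<alpha> j \<and> \<alpha> j < 1"
    and XA: "X \<subseteq> adversaries m" and YA: "Y \<subseteq> adversaries m" and XY: "X \<inter> Y = {}"
    and tau_max: "\<forall>t. saddle_obj m p \<alpha> X Y t \<le> saddle_obj m p \<alpha> X Y \<tau>"
    and XSC: "X = S \<union> C"
    and S_lt: "\<forall>j \<in> S. \<zeta> j < 1"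
    and C_eq: "\<forall>j \<in> C. \<zeta> j = 1"
    and Y_lt: "\<forall>j \<in> Y. \<zeta> j < 1"
  shows "(\<lambda>n. prob_XY m p \<alpha> n X Y) \<sim>[at_top]
    (\<lambda>n. polyPXY m p X Y \<zeta> ^ n /
          ((\<Prod>j\<in>S. \<zeta> j powr real_of_int (\<lceil>\<beta> j * real n\<rceil> - 1)) *
           (\<Prod>j\<in>Y. \<zeta> j powr real_of_int \<lfloor>\<alpha> j * real n\<rfloor>))
        * (1 / (\<Prod>j \<in> S \<union> Y. 1 - \<zeta> j))
        * (1 / sqrt ((2 * pi) ^ card (X \<union> Y) * real n ^ card (S \<union> Y) * det_on (X \<union> Y) H))
        * (LINT u : {u \<in> space (PiM C (\<lambda>_. lborel)). \<forall>j\<in>C. 0 < u j} | PiM C (\<lambda>_. lborel).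
             exp (- (\<Sum>i\<in>C. \<Sum>j\<in>C. u i * inverse_on (X \<union> Y) H i j * u j) / 2)))"
proof -
  let ?R = "rankings m" and ?I = "X \<union> Y" and ?W = "step m X"
  let ?mgf = "mgf ?R ?I ?W"
  define \<theta> where "\<theta> j = (if j \<in> X then 1 - \<alpha> j else \<alpha> j)" for j
  define k where "k n j = (if j \<in> X then \<lceil>(1 - \<alpha> j) * real n\<rceil> - 1 else \<lfloor>\<alpha> j * real n\<rfloor>)" for n j
  define Z where "Z = ?mgf p \<tau>"
  define q where "q r = p r * exp (\<Sum>l\<in>?I. \<tau> l * ?W r l) / Z" for r
  define \<epsilon> where "\<epsilon> = Min (q ` ?R)"
  have finA: "finite (adversaries m)" by (simp add: adversaries_def)
  have finX: "finite X" and finY: "finite Y" using XA YA finA by (auto intro: finite_subset)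
  have finI: "finite ?I" using finX finY by simp
  have R_ne: "?R \<noteq> {}" using p_sum by auto
  have Z_t: "?mgf p t > 0" for t
    using p_pos R_ne by (intro mgf_pos finite_rankings) auto
  have Z_pos: "Z > 0" unfolding Z_def by (rule Z_t)
  have PXY: "polyPXY m p X Y (\<lambda>j. exp (t j)) = ?mgf p t" for t
    by (rule polyPXY_exp[OF m2 XA YA XY])
  then have K: "Ktilde m p X Y = (\<lambda>t. ln (?mgf p t))" by (simp add: Ktilde_def fun_eq_iff)
  have q_pos: "q r > 0" if "r \<in> ?R" for r
    using p_pos that Z_pos by (simp add: q_def)
  have "\<epsilon> > 0" unfolding \<epsilon>_def using q_pos finite_rankings R_ne by simp
  have q_ge: "\<epsilon> \<le> q r" if "r \<in> ?R" for r
    unfolding \<epsilon>_def using that finite_rankings by simp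
  have pattern: "\<exists>r\<in>?R. \<forall>j\<in>?I. ?W r j = (if j \<in> B then 1 else 0)" if B: "B \<subseteq> ?I" for B
  proof -
    \<comment> \<open>On Y a bit is 1 when m is above j, so the set ranked above m is complemented
      there.\<close>
    have "(X \<inter> B) \<union> (Y - B) \<subseteq> adversaries m" using XA YA by auto
    from ranking_with_above_set[OF m2 this] obtain r where r: "r \<in> ?R"
      "\<And>j. j \<in> adversaries m \<Longrightarrow> ranks_above r j m \<longleftrightarrow> j \<in> (X \<inter> B) \<union> (Y - B)" by blast
    have "?W r j = (if j \<in> B then 1 else 0)" if j: "j \<in> ?I" for j
    proof -
      have ja: "j \<in> adversaries m" using j XA YA by auto
      show ?thesis
        using j XY r(2)[OF ja] rankings_above_total[OF m2 r(1) ja] by (auto simp: step_def)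
    qed
    then show ?thesis using r(1) by blast
  qed
  interpret lattice_walk ?R ?I ?W q \<epsilon>
  proof
    show "(\<Sum>r\<in>?R. q r) = 1"
      using Z_pos by (simp add: q_def Z_def mgf_def flip: sum_divide_distrib)
    show "\<exists>r\<in>?R. \<forall>j\<in>?I. ?W r j = 0" using pattern[of "{}"] by simp
    show "\<exists>r\<in>?R. \<forall>j\<in>?I. ?W r j = (if j = i then 1 else 0)" if "i \<in> ?I" for i
      using pattern[of "{i}"] that by simp
    show "?W r j \<le> 1" for r j by (simp add: step_def)
  qed (use finite_rankings finI \<open>\<epsilon> > 0\<close> q_ge in auto)
  have q_expect: "(\<Sum>r\<in>?R. q r * f r) = ?mgf (\<lambda>r. p r * f r) \<tau> / Z" for f
    by (simp add: q_def mgf_def sum_divide_distrib mult_ac)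
  have mean_tilted: "mean j = tilted_mean ?R ?I ?W p \<tau> j" for j
    unfolding mean_def q_expect tilted_mean_def Z_def ..
  have H_cov: "H i j = cov i j" if ij: "i \<in> ?I" "j \<in> ?I" for i j
  proof -
    have "cov i j = (\<Sum>r\<in>?R. q r * (real (?W r i) * ?W r j)) - mean j * (\<Sum>r\<in>?R. q r * ?W r i)
        - mean i * (\<Sum>r\<in>?R. q r * ?W r j) + mean i * mean j * (\<Sum>r\<in>?R. q r)"
      unfolding cov_def sum_distrib_left sum_subtractf[symmetric] sum.distrib[symmetric]
      by (intro sum.cong refl) (simp add: algebra_simps)
    also have "\<dots> = ?mgf (\<lambda>r. p r * (real (?W r i) * ?W r j)) \<tau> / Z - mean i * mean j"
      unfolding q_sum mean_def[symmetric] q_expect by simp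
    also have "\<dots> = H i j"
      unfolding H_def K hessian_ln_mgf[OF finI ij Z_t] mean_tilted Z_def by (simp add: mult.assoc)
    finally show ?thesis ..
  qed
  \<comment> \<open>First-order condition at the maximizer, taken along each coordinate
    line.\<close>
  have mean_eq: "mean i = \<theta> i" if i: "i \<in> ?I" for i
  proof -
    have obj: "saddle_obj m p \<alpha> X Y t = - ln (?mgf p t) + (\<Sum>j\<in>?I. \<theta> j * t j)" for t
    proof -
      have "(\<Sum>j\<in>?I. \<theta> j * t j) = (\<Sum>j\<in>X. \<theta> j * t j) + (\<Sum>j\<in>Y. \<theta> j * t j)"
        by (rule sum.union_disjoint[OF finX finY XY])
      also have "(\<Sum>j\<in>Y. \<theta> j * t j) = (\<Sum>j\<in>Y. \<alpha> j * t j)"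
        using XY by (intro sum.cong) (auto simp: \<theta>_def)
      finally show ?thesis by (simp add: saddle_obj_def K \<theta>_def)
    qed
    have "((\<lambda>s. saddle_obj m p \<alpha> X Y (\<tau>(i := s))) has_real_derivative
        - tilted_mean ?R ?I ?W p \<tau> i + \<theta> i) (at (\<tau> i))"
    proof -
      have lin: "(\<Sum>j\<in>?I. \<theta> j * (\<tau>(i := s)) j) = \<theta> i * s + (\<Sum>j\<in>?I - {i}. \<theta> j * \<tau> j)" for s
        by (subst sum.remove[OF finI i]) (auto intro!: sum.cong)
      have "((\<lambda>s. \<theta> i * s + (\<Sum>j\<in>?I - {i}. \<theta> j * \<tau> j)) has_real_derivative \<theta> i) (at (\<tau> i))"
        by (auto intro!: derivative_eq_intros)
      from DERIV_add[OF DERIV_minus[OF ln_mgf_has_partial_derivative[OF finI i Z_t[of \<tau>]]] this]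
      show ?thesis unfolding obj lin .
    qed
    then have "- tilted_mean ?R ?I ?W p \<tau> i + \<theta> i = 0"
      by (rule DERIV_local_max[of _ _ _ 1]) (use tau_max in \<open>simp_all add: fun_upd_idem\<close>)
    then show ?thesis by (simp add: mean_tilted)
  qed
  \<comment> \<open>The ceiling minus 1 and the floor both lie within 1 of the exact
    threshold.\<close>
  have k_mean: "\<bar>k n j - n * mean j\<bar> \<le> 1" if j: "j \<in> ?I" for n j
    unfolding mean_eq[OF j] k_def \<theta>_def
    by (cases "j \<in> X"; simp add: mult.commute; linarith)
  have \<zeta>_pos: "\<zeta> j > 0" for j by (simp add: \<zeta>_def)
  have IC: "?I - C = S \<union> Y" and CI: "C \<subseteq> ?I" and SC: "S \<inter> C = {}"
    using XSC S_lt C_eq Y_lt by force+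
  have \<zeta>_lt: "0 < \<zeta> j \<and> \<zeta> j < 1" if "j \<in> ?I - C" for j
    using that S_lt Y_lt \<zeta>_pos unfolding IC by auto
  have \<zeta>_C: "\<zeta> j = 1" if "j \<in> C" for j using C_eq that by blast
  note lim = orthant_limit[OF CI \<zeta>_C \<zeta>_lt k_mean]
  \<comment> \<open>The identity is exact for every n: the prefactor and the weights in
    \<open>orthant_sum\<close> together undo the tilt. Real powers are used because on X the
    exponent is -1 at n = 0.\<close>
  have prob: "prob_XY m p \<alpha> n X Y = Z ^ n / (\<Prod>j\<in>?I. \<zeta> j powr k n j) * orthant_sum \<zeta> n (k n)" for n
  proof -
    let ?V = "PiE {..<n} (\<lambda>_. ?R)"
    let ?N = "\<lambda>v j. \<Sum>i<n. ?W (v i) j"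
    have finV: "finite ?V" by (intro finite_PiE) (auto simp: finite_rankings)
    have prod_p: "(\<Prod>i<n. p (v i)) = Z ^ n / (\<Prod>j\<in>?I. \<zeta> j powr k n j) *
        ((\<Prod>i<n. q (v i)) * (\<Prod>j\<in>?I. \<zeta> j ^ nat (k n j - int (?N v j))))"
      if N: "\<forall>j\<in>?I. int (?N v j) \<le> k n j" for v
    proof -
      have "(\<Prod>i<n. q (v i)) = (\<Prod>i<n. p (v i)) * (\<Prod>i<n. exp (\<Sum>l\<in>?I. \<tau> l * ?W (v i) l)) / Z ^ n"
        by (simp add: q_def prod_dividef prod.distrib)
      also have "(\<Prod>i<n. exp (\<Sum>l\<in>?I. \<tau> l * ?W (v i) l)) = exp (\<Sum>l\<in>?I. \<tau> l * ?N v l)"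
        by (subst exp_sum[symmetric], simp, subst sum.swap) (simp add: sum_distrib_left)
      also have "\<dots> = (\<Prod>l\<in>?I. \<zeta> l powr ?N v l)"
        by (subst exp_sum[OF finI]) (simp add: \<zeta>_def powr_def mult.commute)
      finally have q: "(\<Prod>i<n. q (v i)) = (\<Prod>i<n. p (v i)) * (\<Prod>l\<in>?I. \<zeta> l powr ?N v l) / Z ^ n" .
      have "(\<Prod>l\<in>?I. \<zeta> l powr ?N v l) * (\<Prod>j\<in>?I. \<zeta> j ^ nat (k n j - int (?N v j))) = (\<Prod>j\<in>?I. \<zeta> j powr k n j)"
        unfolding prod.distrib[symmetric]
      proof (intro prod.cong refl)
        fix j assume j: "j \<in> ?I"
        have "\<zeta> j ^ nat (k n j - int (?N v j)) = \<zeta> j powr (real_of_int (k n j) - real (?N v j))"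
          using N j \<zeta>_pos[of j] by (subst powr_realpow[symmetric]) (auto simp del: of_nat_sum)
        then show "\<zeta> j powr ?N v j * \<zeta> j ^ nat (k n j - int (?N v j)) = \<zeta> j powr k n j"
          by (simp flip: powr_add del: of_nat_sum)
      qed
      moreover have "(\<Prod>j\<in>?I. \<zeta> j powr k n j) > 0" using \<zeta>_pos by (intro prod_pos) (simp add: less_imp_neq[THEN not_sym])
      ultimately show ?thesis unfolding q using Z_pos by (simp add: field_simps)
    qed
    have "prob_XY m p \<alpha> n X Y = (\<Sum>v\<in>?V. if \<forall>j\<in>?I. int (?N v j) \<le> k n j then \<Prod>i<n. p (v i) else 0)"
      unfolding prob_XY_def sum.inter_filter[OF finV]
      by (intro sum.cong refl) (simp only: event_XY_iff_steps[OF m2 XA YA XY] k_def)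
    also have "\<dots> = Z ^ n / (\<Prod>j\<in>?I. \<zeta> j powr k n j) * orthant_sum \<zeta> n (k n)"
      unfolding orthant_sum_def sum_distrib_left
      by (intro sum.cong refl) (simp only: prod_p if_distrib[of "\<lambda>x. _ * x"] mult_zero_right cong: if_cong)
    finally show ?thesis .
  qed
  have powers: "(\<Prod>j\<in>?I. \<zeta> j powr k n j) = (\<Prod>j\<in>S. \<zeta> j powr real_of_int (\<lceil>\<beta> j * real n\<rceil> - 1)) *
           (\<Prod>j\<in>Y. \<zeta> j powr real_of_int \<lfloor>\<alpha> j * real n\<rfloor>)" for n
  proof -
    have "(\<Prod>j\<in>?I. \<zeta> j powr k n j) = (\<Prod>j\<in>X. \<zeta> j powr k n j) * (\<Prod>j\<in>Y. \<zeta> j powr k n j)"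
      by (rule prod.union_disjoint[OF finX finY XY])
    \<comment> \<open>The indices of X outside S lie in C, where the base is 1.\<close>
    also have "(\<Prod>j\<in>X. \<zeta> j powr k n j) = (\<Prod>j\<in>S. \<zeta> j powr k n j)"
      using XSC finX \<zeta>_C by (intro prod.mono_neutral_right) auto
    also have "\<dots> = (\<Prod>j\<in>S. \<zeta> j powr real_of_int (\<lceil>\<beta> j * real n\<rceil> - 1))"
      using XSC by (intro prod.cong) (auto simp: k_def \<beta>_def)
    also have "(\<Prod>j\<in>Y. \<zeta> j powr k n j) = (\<Prod>j\<in>Y. \<zeta> j powr real_of_int \<lfloor>\<alpha> j * real n\<rfloor>)"
      using XY by (intro prod.cong) (auto simp: k_def)
    finally show ?thesis .
  qed
  have det: "det_on ?I H = det_on ?I cov" by (rule det_on_cong) (rule H_cov)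
  have inv: "inverse_on ?I H = inverse_on ?I cov" by (rule inverse_on_cong) (rule H_cov)
  have PZ: "polyPXY m p X Y \<zeta> = Z" unfolding \<zeta>_def PXY Z_def ..
  show ?thesis (is "?f \<sim>[at_top] ?g")
  proof (rule asymp_equivI')
    let ?A = "\<lambda>n. sqrt n ^ card (S \<union> Y) * orthant_sum \<zeta> n (k n)"
    define J where "J = (LINT u : {u \<in> space (PiM C (\<lambda>_. lborel)). \<forall>j\<in>C. 0 < u j} | PiM C (\<lambda>_. lborel).
             exp (- (\<Sum>i\<in>C. \<Sum>j\<in>C. u i * inverse_on ?I cov i j * u j) / 2))"
    define D where "D = sqrt ((2 * pi) ^ card ?I * det_on ?I cov)"
    define G where "G = (\<Prod>j\<in>S \<union> Y. 1 - \<zeta> j)"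
    define L where "L = 1 / G * (J / D)"
    have L: "?A \<longlonglongrightarrow> L" "L > 0"
      using lim unfolding IC L_def G_def J_def D_def by (simp_all add: prod_dividef)
    \<comment> \<open>The exponential factors cancel exactly, so the limit of the rescaled orthant
      sum is all that is needed.\<close>
    have "?f n / ?g n = ?A n / L" if n: "n > 0" for n
    proof -
      define B where "B = (\<Prod>j\<in>?I. \<zeta> j powr k n j)"
      have B: "B > 0" unfolding B_def using \<zeta>_pos by (intro prod_pos) (simp add: less_imp_neq[THEN not_sym])
      have root: "sqrt ((2 * pi) ^ card ?I * real n ^ card (S \<union> Y) * det_on ?I cov) = D * sqrt n ^ card (S \<union> Y)"
        by (simp add: D_def real_sqrt_mult real_sqrt_power)
      have g: "?g n = Z ^ n / B * (1 / G) * (1 / (D * sqrt n ^ card (S \<union> Y))) * J"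
        unfolding PZ det inv powers[symmetric] root B_def G_def J_def ..
      have f: "?f n = Z ^ n / B * orthant_sum \<zeta> n (k n)" unfolding prob B_def ..
      show ?thesis unfolding f g L_def using B Z_pos n by simp
    qed
    then have ev: "\<forall>\<^sub>F n in at_top. ?A n / L = ?f n / ?g n"
      by (intro eventually_mono[OF eventually_gt_at_top[of 0]]) simp
    have "(\<lambda>n. ?A n / L) \<longlonglongrightarrow> L / L"
      using L by (intro tendsto_divide tendsto_const) auto
    then show "(\<lambda>n. ?f n / ?g n) \<longlonglongrightarrow> 1"
      using L(2) by (intro Lim_transform_eventually[OF _ ev]) simp
  qed
qed

end
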